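(* Let $k\in\mathbb{N}$, let $p>2$ be a prime, let $m\ge 1$ be an integer, and let $F$ be an infinite field of characteristic $0$ or $p$. Then the $\mathbb{Z}_2$-graded Gelfand-Kirillov dimension of $E_{k^*}$ in $m$ variables over $F$ is $$\mathrm{GKdim}_m^{\mathbb{Z}_2}(E_{k^*})=m.$$
   Context: All algebras are associative and unitary. $E$ is the infinite dimensional unitary Grassmann algebra over $F$, generated by $e_1,e_2,\dots$ with relations $e_ie_j+e_je_i=0$ for all $i,j$; it has basis $\{e_{i_1}\cdots e_{i_n}\mid n\ge 0,\ i_1<\cdots<i_n\}$. $E_{k^*}$ denotes $E$ with the $\mathbb{Z}_2$-grading induced by $\deg(e_i)=1$ for $i=1,\dots,k$ and $\deg(e_i)=0$ otherwise (a monomial has degree the sum of the degrees of its factors). For a $\mathbb{Z}_2$-graded algebra $B=B^0\oplus B^1$, $T_{\mathbb{Z}_2}(B)$ is the ideal of $\mathbb{Z}_2$-graded polynomial identities of $B$, i.e. the polynomials in the free associative algebra on variables $y_i$ (degree $0$) and $z_i$ (degree $1$) vanishing whenever the $y_i$ are replaced by arbitrary elements of $B^0$ and the $z_i$ by arbitrary elements of $B^1$. The relatively-free $\mathbb{Z}_2$-graded algebra in $m$ variables is $$F_m^{\mathbb{Z}_2}(B)=F\langle y_1,\dots,y_m,z_1,\dots,z_m\rangle/\big(F\langle y_1,\dots,y_m,z_1,\dots,z_m\rangle\cap T_{\mathbb{Z}_2}(B)\big),$$ and $\mathrm{GKdim}_m^{\mathbb{Z}_2}(B):=\mathrm{GKdim}(F_m^{\mathbb{Z}_2}(B))$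 is its Gelfand-Kirillov dimension. *)

theory Defs
  imports
    "HOL-Library.Poly_Mapping"
    "HOL-Library.Extended_Real"
    "HOL-Computational_Algebra.Primes"
    "HOL-Algebra.QuotRing"
    "HOL-Algebra.Embedded_Algebras"
begin

section \<open>Associative unitary algebras over a field\<close>

text \<open>
  An algebra over the field \<^typ>\<open>'f\<close> is a (not necessarily commutative) ring together with its
  structure map, the ring homomorphism from \<^typ>\<open>'f\<close> to the centre sending \<open>c\<close> to \<open>c \<cdot> 1\<close>.
  With \<open>scalars A\<close> as the field, the linear algebra of \<^theory>\<open>HOL-Algebra.Embedded_Algebras\<close>
  applies to any nonzero algebra.
\<close>

record ('f, 'a) falgebra = "'a ring" +
  of_scalar :: "'f \<Rightarrow> 'a"

definition scalars :: "('f, 'a, 'm) falgebra_scheme \<Rightarrow> 'a set" where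
  "scalars A = range (of_scalar A)"

definition lin_span :: "('f, 'a, 'm) falgebra_scheme \<Rightarrow> 'a set \<Rightarrow> 'a set" where
  "lin_span A S = (\<Union>us\<in>lists S. ring.Span A (scalars A) us)"

definition list_prod :: "('a, 'm) ring_scheme \<Rightarrow> 'a list \<Rightarrow> 'a" where
  "list_prod R xs = foldr (\<lambda>x y. x \<otimes>\<^bsub>R\<^esub> y) xs \<one>\<^bsub>R\<^esub>"

definition quot_alg :: "('f, 'a, 'm) falgebra_scheme \<Rightarrow> 'a set \<Rightarrow> ('f, 'a set) falgebra" where
  "quot_alg A I =
     ring.extend (A Quot I) (falgebra.fields (\<lambda>c. I +>\<^bsub>A\<^esub> of_scalar A c))"


section \<open>Gelfand--Kirillov dimension\<close>

text \<open>The subspace \<open>V\<^sup>0 + V\<^sup>1 + \<dots> + V\<^sup>n\<close>, where \<open>V\<^sup>0\<close> is the line of scalars.\<close>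

definition power_sum :: "('f, 'a, 'm) falgebra_scheme \<Rightarrow> 'a set \<Rightarrow> nat \<Rightarrow> 'a set" where
  "power_sum A V n = lin_span A (list_prod A ` {vs \<in> lists V. length vs \<le> n})"

text \<open>
  The supremum is over all finite-dimensional subspaces; \<^const>\<open>ring.finite_dimension\<close>
  includes being a subspace.
\<close>

definition GKdim :: "('f, 'a, 'm) falgebra_scheme \<Rightarrow> ereal" where
  "GKdim A = (SUP V \<in> {V. ring.finite_dimension A (scalars A) V}.
     limsup (\<lambda>n. ereal (log (real n) (real (ring.dim A (scalars A) (power_sum A V n))))))"


section \<open>Free associative algebras\<close>

text \<open>
  The free algebra is the algebra of the free monoid: a polynomial is a finitely supported
  function from words to coefficients, multiplied by convolution. The monoid operation on words,
  concatenation, is written additively because \<^theory>\<open>HOL-Library.Poly_Mapping\<close> requires it.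
\<close>

datatype 'x fword = FWord (letters: "'x list")

instantiation fword :: (type) monoid_add
begin

definition zero_fword :: "'x fword" where
  "zero_fword = FWord []"

definition plus_fword :: "'x fword \<Rightarrow> 'x fword \<Rightarrow> 'x fword" where
  "plus_fword u v = FWord (letters u @ letters v)"

instance
  by intro_classes (simp_all add: zero_fword_def plus_fword_def)

end

type_synonym ('x, 'f) fpoly = "'x fword \<Rightarrow>\<^sub>0 'f"

definition fmonom :: "'x list \<Rightarrow> ('x, 'f::field) fpoly" where
  "fmonom xs = Poly_Mapping.single (FWord xs) 1"

definition free_alg :: "'x set \<Rightarrow> ('f::field, ('x, 'f) fpoly) falgebra" where
  "free_alg X =
     \<lparr>carrier = {f. \<forall>w\<in>Poly_Mapping.keys f. set (letters w) \<subseteq> X},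
      mult = (*), one = 1, zero = 0, add = (+),
      of_scalar = Poly_Mapping.single 0\<rparr>"

definition eval_fpoly ::
    "('f::field, 'a, 'm) falgebra_scheme \<Rightarrow> ('x \<Rightarrow> 'a) \<Rightarrow> ('x, 'f) fpoly \<Rightarrow> 'a" where
  "eval_fpoly B \<phi> f =
     (\<Oplus>\<^bsub>B\<^esub>w\<in>Poly_Mapping.keys f.
        of_scalar B (Poly_Mapping.lookup f w) \<otimes>\<^bsub>B\<^esub> list_prod B (map \<phi> (letters w)))"


section \<open>Graded identities and relatively free graded algebras\<close>

record ('f, 'a) z2_algebra = "('f, 'a) falgebra" +
  deg0 :: "'a set"
  deg1 :: "'a set"

datatype gvar = Y nat | Z nat

definition T_Z2 :: "('f::field, 'a, 'm) z2_algebra_scheme \<Rightarrow> (gvar, 'f) fpoly set" where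
  "T_Z2 B = {f. \<forall>\<phi>. (\<forall>i. \<phi> (Y i) \<in> deg0 B \<and> \<phi> (Z i) \<in> deg1 B) \<longrightarrow> eval_fpoly B \<phi> f = \<zero>\<^bsub>B\<^esub>}"

definition free_alg_YZ :: "nat \<Rightarrow> ('f::field, (gvar, 'f) fpoly) falgebra" where
  "free_alg_YZ m = free_alg (Y ` {1..m} \<union> Z ` {1..m})"

definition rel_free_Z2 ::
    "nat \<Rightarrow> ('f::field, 'a, 'm) z2_algebra_scheme \<Rightarrow> ('f, (gvar, 'f) fpoly set) falgebra" where
  "rel_free_Z2 m B = quot_alg (free_alg_YZ m) (carrier (free_alg_YZ m) \<inter> T_Z2 B)"

definition GKdim_Z2 :: "nat \<Rightarrow> ('f::field, 'a, 'm) z2_algebra_scheme \<Rightarrow> ereal" where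
  "GKdim_Z2 m B = GKdim (rel_free_Z2 m B)"


section \<open>The Grassmann algebra and its gradings\<close>

text \<open>
  The Grassmann algebra is given by its presentation; the generators are indexed by the positive
  integers, and \<open>grassmann_ideal\<close> is a two-sided ideal of the free algebra on them.
\<close>

definition grassmann_ideal :: "(nat, 'f::field) fpoly set" where
  "grassmann_ideal =
     genideal (free_alg {1..}) {fmonom [i, j] + fmonom [j, i] | i j. 1 \<le> i \<and> 1 \<le> j}"

definition grassmann :: "('f::field, (nat, 'f) fpoly set) falgebra" where
  "grassmann = quot_alg (free_alg {1..}) grassmann_ideal"

text \<open>The basis monomial \<open>e\<^sub>i\<^sub>1 \<cdots> e\<^sub>i\<^sub>n\<close> for a strictly increasing list of indices.\<close>

definition grassmann_monom :: "nat list \<Rightarrow> (nat, 'f::field) fpoly set" where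
  "grassmann_monom is = grassmann_ideal +>\<^bsub>free_alg {1..}\<^esub> fmonom is"

definition star_degree :: "nat \<Rightarrow> nat list \<Rightarrow> nat" where
  "star_degree k is = (\<Sum>i\<leftarrow>is. if i \<le> k then 1 else 0)"

definition star_component :: "nat \<Rightarrow> nat \<Rightarrow> (nat, 'f::field) fpoly set set" where
  "star_component k d = lin_span grassmann
     {grassmann_monom is | is. set is \<subseteq> {1..} \<and> sorted_wrt (<) is \<and> star_degree k is mod 2 = d}"

definition grassmann_star :: "nat \<Rightarrow> ('f::field, (nat, 'f) fpoly set) z2_algebra" where
  "grassmann_star k =
     falgebra.extend grassmann
       (z2_algebra.fields (star_component k 0) (star_component k 1))"


section \<open>Well-definedness\<close>

text \<open>
  Every quotient above is by a two-sided ideal, and the scalars of the relatively free algebra form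
  a subfield, so \<^const>\<open>ring.dim\<close> and \<^const>\<open>ring.finite_dimension\<close> have their intended meaning.
\<close>

lemma keys_fword_mult:
  fixes f g :: "('x, 'f::field) fpoly"
  assumes "w \<in> Poly_Mapping.keys (f * g)"
  shows "\<exists>u\<in>Poly_Mapping.keys f. \<exists>v\<in>Poly_Mapping.keys g. w = u + v"
  using assms keys_mult[of f g] by blast

lemma ring_free_alg:
  fixes X :: "'x set"
  shows "ring (free_alg X :: ('f::field, ('x, 'f) fpoly) falgebra)" (is "ring ?A")
proof (rule ringI)
  show "abelian_group ?A"
  proof (rule abelian_groupI)
    fix f assume f: "f \<in> carrier ?A"
    show "\<exists>g\<in>carrier ?A. g \<oplus>\<^bsub>?A\<^esub> f = \<zero>\<^bsub>?A\<^esub>"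
      using f by (intro bexI[of _ "- f"]) (auto simp: free_alg_def)
  next
    fix f g assume "f \<in> carrier ?A" "g \<in> carrier ?A"
    then show "f \<oplus>\<^bsub>?A\<^esub> g \<in> carrier ?A"
      using keys_add[of f g] by (auto simp: free_alg_def)
  qed (auto simp: free_alg_def algebra_simps)
  show "monoid ?A"
  proof (rule monoidI)
    fix f g assume "f \<in> carrier ?A" "g \<in> carrier ?A"
    then show "f \<otimes>\<^bsub>?A\<^esub> g \<in> carrier ?A"
      by (fastforce simp: free_alg_def plus_fword_def dest!: keys_fword_mult)
  qed (auto simp: free_alg_def zero_fword_def algebra_simps)
qed (auto simp: free_alg_def algebra_simps)

lemma quot_alg_simps [simp]:
  "carrier (quot_alg A I) = carrier (A Quot I)"
  "mult (quot_alg A I) = mult (A Quot I)"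
  "one (quot_alg A I) = one (A Quot I)"
  "zero (quot_alg A I) = zero (A Quot I)"
  "add (quot_alg A I) = add (A Quot I)"
  "of_scalar (quot_alg A I) c = I +>\<^bsub>A\<^esub> of_scalar A c"
  by (simp_all add: quot_alg_def ring.defs falgebra.defs)

lemma ring_quot_alg:
  assumes "ideal I A"
  shows "ring (quot_alg A I)"
proof -
  interpret Q: ring "A Quot I"
    using assms by (rule ideal.quotient_is_ring)
  have neg: "\<exists>y\<in>carrier (A Quot I). y \<oplus>\<^bsub>A Quot I\<^esub> x = \<zero>\<^bsub>A Quot I\<^esub>"
    if "x \<in> carrier (A Quot I)" for x
    using that Q.l_neg Q.a_inv_closed by blast
  show ?thesis
    by (intro ringI abelian_groupI monoidI)
      (simp_all add: neg Q.l_distr Q.r_distr Q.m_assoc Q.a_ac)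
qed

lemma ideal_grassmann_ideal: "ideal grassmann_ideal (free_alg {1..})"
  unfolding grassmann_ideal_def
  by (rule ring.genideal_ideal[OF ring_free_alg])
    (auto simp: free_alg_def fmonom_def dest!: subsetD[OF keys_add] split: if_splits)

lemma ring_grassmann: "ring grassmann"
  unfolding grassmann_def by (rule ring_quot_alg[OF ideal_grassmann_ideal])


lemma poly_mapping_induct [case_names zero single sum]:
  fixes f :: "'b \<Rightarrow>\<^sub>0 'c::monoid_add"
  assumes "P 0" "\<And>u a. P (Poly_Mapping.single u a)" "\<And>f g. P f \<Longrightarrow> P g \<Longrightarrow> P (f + g)"
  shows "P f"
proof (induction f rule: update_induct)
  case const then show ?case by (rule assms(1))
next
  case (update f a b)
  have "Poly_Mapping.update a b f = Poly_Mapping.single a b + f"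
    using update(1) by (intro poly_mapping_eqI)
      (auto simp: lookup_update lookup_add lookup_single in_keys_iff)
  then show ?case using assms(2,3) update by metis
qed

locale f_algebra = ring A for A :: "('f::field, 'a, 'm) falgebra_scheme" (structure) +
  assumes sc_closed [simp, intro]: "of_scalar A c \<in> carrier A"
    and sc_add: "of_scalar A (c + d) = of_scalar A c \<oplus> of_scalar A d"
    and sc_mult: "of_scalar A (c * d) = of_scalar A c \<otimes> of_scalar A d"
    and sc_one: "of_scalar A 1 = \<one>"
    and sc_central: "x \<in> carrier A \<Longrightarrow> of_scalar A c \<otimes> x = x \<otimes> of_scalar A c"
begin

lemma sc_zero: "of_scalar A 0 = \<zero>"
  using sc_add[of 0 0] by (metis add.l_cancel_one' add_0 sc_closed)

lemma list_prod_closed: "set xs \<subseteq> carrier A \<Longrightarrow> list_prod A xs \<in> carrier A"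
  by (induction xs) (auto simp: list_prod_def)

lemma list_prod_append:
  "set xs \<subseteq> carrier A \<Longrightarrow> set ys \<subseteq> carrier A \<Longrightarrow>
    list_prod A (xs @ ys) = list_prod A xs \<otimes> list_prod A ys"
proof (induction xs)
  case Nil then show ?case using list_prod_closed[of ys] by (simp add: list_prod_def)
next
  case (Cons x xs)
  then show ?case using list_prod_closed[of ys] list_prod_closed[of xs]
    by (simp add: list_prod_def m_assoc)
qed

context
  fixes \<phi> :: "'x \<Rightarrow> 'a"
  assumes phi: "\<And>x. \<phi> x \<in> carrier A"
begin

lemma word_closed: "list_prod A (map \<phi> xs) \<in> carrier A"
  using phi by (intro list_prod_closed) auto

lemma eval_superset:
  assumes "finite S" "Poly_Mapping.keys f \<subseteq> S"
  shows "eval_fpoly A \<phi> f = (\<Oplus>w\<in>S. of_scalar A (Poly_Mapping.lookup f w) \<otimes> list_prod A (map \<phi> (letters w)))"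
  unfolding eval_fpoly_def
  by (rule add.finprod_mono_neutral_cong_left)
     (use assms word_closed in \<open>auto simp: in_keys_iff sc_zero\<close>)

lemma eval_closed: "eval_fpoly A \<phi> f \<in> carrier A"
  unfolding eval_fpoly_def using word_closed by (intro finsum_closed) auto

lemma eval_add: "eval_fpoly A \<phi> (f + g) = eval_fpoly A \<phi> f \<oplus> eval_fpoly A \<phi> g"
proof -
  let ?S = "Poly_Mapping.keys f \<union> Poly_Mapping.keys g"
  have "eval_fpoly A \<phi> (f + g) = (\<Oplus>w\<in>?S. of_scalar A (Poly_Mapping.lookup (f + g) w) \<otimes> list_prod A (map \<phi> (letters w)))"
    using keys_add[of f g] by (intro eval_superset) auto
  also have "\<dots> = (\<Oplus>w\<in>?S. of_scalar A (Poly_Mapping.lookup f w) \<otimes> list_prod A (map \<phi> (letters w))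
       \<oplus> of_scalar A (Poly_Mapping.lookup g w) \<otimes> list_prod A (map \<phi> (letters w)))"
    using word_closed by (intro finsum_cong') (auto simp: lookup_add sc_add l_distr)
  also have "\<dots> = eval_fpoly A \<phi> f \<oplus> eval_fpoly A \<phi> g"
    using word_closed by (subst finsum_addf) (auto simp: eval_superset[of ?S f] eval_superset[of ?S g])
  finally show ?thesis .
qed

lemma eval_0: "eval_fpoly A \<phi> 0 = \<zero>"
  by (simp add: eval_fpoly_def)

lemma eval_single: "eval_fpoly A \<phi> (Poly_Mapping.single u a) = of_scalar A a \<otimes> list_prod A (map \<phi> (letters u))"
  using word_closed by (subst eval_superset[of "{u}"]) (auto simp: finsum_insert)

lemma eval_mult_single: "eval_fpoly A \<phi> (Poly_Mapping.single u a * g) = eval_fpoly A \<phi> (Poly_Mapping.single u a) \<otimes> eval_fpoly A \<phi> g"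
proof (induction g rule: poly_mapping_induct)
  case zero then show ?case by (simp add: eval_0 eval_closed)
next
  case (single v b)
  have sw: "of_scalar A b \<otimes> (list_prod A (map \<phi> (letters u)) \<otimes> z) = list_prod A (map \<phi> (letters u)) \<otimes> (of_scalar A b \<otimes> z)"
    if "z \<in> carrier A" for z
    using that word_closed sc_central sc_closed by (metis m_assoc)
  have "list_prod A (map \<phi> (letters u) @ map \<phi> (letters v)) = list_prod A (map \<phi> (letters u)) \<otimes> list_prod A (map \<phi> (letters v))"
    using phi by (intro list_prod_append) auto
  then show ?case using word_closed sw
    by (simp add: mult_single eval_single plus_fword_def sc_mult m_assoc)
next
  case (sum f g)
  then show ?case by (simp add: distrib_left eval_add r_distr eval_closed)
qed

lemma eval_mult: "eval_fpoly A \<phi> (f * g) = eval_fpoly A \<phi> f \<otimes> eval_fpoly A \<phi> g"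
proof (induction f rule: poly_mapping_induct)
  case zero then show ?case by (simp add: eval_0 eval_closed)
next
  case (single v b)
  show ?case by (rule eval_mult_single)
next
  case (sum f g)
  then show ?case by (simp add: distrib_right eval_add l_distr eval_closed)
qed

end

lemma eval_neg:
  fixes \<phi> :: "'x \<Rightarrow> 'a"
  assumes "\<And>x. \<phi> x \<in> carrier A"
  shows "eval_fpoly A \<phi> (- f) = \<ominus> eval_fpoly A \<phi> f"
proof -
  have "eval_fpoly A \<phi> (- f) \<oplus> eval_fpoly A \<phi> f = \<zero>"
    using eval_add[OF assms, where f = "- f" and g = f] by (simp add: eval_fpoly_def)
  then show ?thesis using eval_closed[OF assms, where f = f] eval_closed[OF assms, where f = "- f"]
    by (simp add: minus_equality)
qed

lemma subfield_scalars:
  assumes "\<one> \<noteq> \<zero>"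
  shows "subfield (scalars A) A"
proof (rule subfieldI)
  have neg: "of_scalar A (- c) = \<ominus> of_scalar A c" for c
    using sc_add[of "- c" c] sc_zero by (simp add: minus_equality)
  have "subring (scalars A) A"
  proof (rule subringI)
    show "\<one> \<in> scalars A" using sc_one by (metis scalars_def rangeI)
  qed (auto simp: scalars_def simp flip: sc_mult sc_add neg)
  then show "subcring (scalars A) A"
    by (rule subcringI) (auto simp: scalars_def mult.commute simp flip: sc_mult)
  have inv: "of_scalar A c \<otimes> of_scalar A (inverse c) = \<one>" if "c \<noteq> 0" for c
    using that by (simp add: sc_one flip: sc_mult)
  show "Units (A\<lparr>carrier := scalars A\<rparr>) = scalars A - {\<zero>}"
  proof (rule Set.set_eqI)
    fix k
    show "k \<in> Units (A\<lparr>carrier := scalars A\<rparr>) \<longleftrightarrow> k \<in> scalars A - {\<zero>}"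
    proof
      assume "k \<in> scalars A - {\<zero>}"
      then obtain c where c: "k = of_scalar A c" "c \<noteq> 0"
        using sc_zero unfolding scalars_def by (metis Diff_iff rangeE singletonI)
      then show "k \<in> Units (A\<lparr>carrier := scalars A\<rparr>)"
        using inv[of c] sc_central[of k "inverse c"]
        by (auto simp: Units_def scalars_def)
    next
      assume "k \<in> Units (A\<lparr>carrier := scalars A\<rparr>)"
      then show "k \<in> scalars A - {\<zero>}"
        using assms by (auto simp: Units_def scalars_def)
    qed
  qed
qed

end

lemma letters_zero: "letters 0 = []"
  by (simp add: zero_fword_def)

lemma f_algebra_free_alg:
  fixes X :: "'x set"
  shows "f_algebra (free_alg X :: ('f::field, ('x, 'f) fpoly) falgebra)"
proof -
  interpret ring "free_alg X :: ('f, ('x, 'f) fpoly) falgebra" by (rule ring_free_alg)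
  show ?thesis
  proof
    fix c d :: 'f and f :: "('x, 'f) fpoly"
    show "of_scalar (free_alg X) c \<otimes>\<^bsub>free_alg X\<^esub> f = f \<otimes>\<^bsub>free_alg X\<^esub> of_scalar (free_alg X) c"
    proof (induction f rule: poly_mapping_induct)
      case (sum f g) then show ?case by (simp add: free_alg_def algebra_simps)
    qed (auto simp: free_alg_def mult_single mult.commute)
  qed (auto simp: free_alg_def single_add mult_single letters_zero)
qed

lemma f_algebra_quot_alg:
  assumes "f_algebra A" "ideal I A"
  shows "f_algebra (quot_alg A I)"
proof -
  interpret A: f_algebra A by fact
  interpret I: ideal I A by fact
  interpret Q: ring "quot_alg A I" by (rule ring_quot_alg[OF assms(2)])
  have h: "(+>\<^bsub>A\<^esub>) I \<in> ring_hom A (A Quot I)" by (rule I.rcos_ring_hom)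
  show ?thesis
  proof
    fix c d x
    show "of_scalar (quot_alg A I) c \<in> carrier (quot_alg A I)"
      using ring_hom_closed[OF h] by simp
    show "of_scalar (quot_alg A I) (c + d) = of_scalar (quot_alg A I) c \<oplus>\<^bsub>quot_alg A I\<^esub> of_scalar (quot_alg A I) d"
      using ring_hom_add[OF h] by (simp add: A.sc_add)
    show "of_scalar (quot_alg A I) (c * d) = of_scalar (quot_alg A I) c \<otimes>\<^bsub>quot_alg A I\<^esub> of_scalar (quot_alg A I) d"
      using ring_hom_mult[OF h] by (simp add: A.sc_mult)
    show "of_scalar (quot_alg A I) 1 = \<one>\<^bsub>quot_alg A I\<^esub>"
      using ring_hom_one[OF h] by (simp add: A.sc_one)
    assume "x \<in> carrier (quot_alg A I)"
    then obtain a where "a \<in> carrier A" "x = I +>\<^bsub>A\<^esub> a"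
      by (auto simp: FactRing_simps)
    then show "of_scalar (quot_alg A I) c \<otimes>\<^bsub>quot_alg A I\<^esub> x = x \<otimes>\<^bsub>quot_alg A I\<^esub> of_scalar (quot_alg A I) c"
      using ring_hom_mult[OF h] A.sc_central by simp (metis A.sc_closed)
  qed
qed

lemma ideal_T_Z2:
  fixes B :: "('f::field, 'a, 'm) z2_algebra_scheme"
  assumes "f_algebra B" "deg0 B \<subseteq> carrier B" "deg1 B \<subseteq> carrier B"
  shows "ideal (carrier (free_alg X) \<inter> T_Z2 B) (free_alg X)"
proof -
  interpret B: f_algebra B by fact
  interpret F: ring "free_alg X :: ('f, (gvar, 'f) fpoly) falgebra" by (rule ring_free_alg)
  have phi: "\<phi> x \<in> carrier B" if "\<forall>i. \<phi> (Y i) \<in> deg0 B \<and> \<phi> (Z i) \<in> deg1 B" for \<phi> x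
    using that assms(2,3) by (cases x) auto
  have ev: "eval_fpoly B \<phi> f \<in> carrier B"
      "eval_fpoly B \<phi> (f + g) = eval_fpoly B \<phi> f \<oplus>\<^bsub>B\<^esub> eval_fpoly B \<phi> g"
      "eval_fpoly B \<phi> (f * g) = eval_fpoly B \<phi> f \<otimes>\<^bsub>B\<^esub> eval_fpoly B \<phi> g"
      "eval_fpoly B \<phi> (- f) = \<ominus>\<^bsub>B\<^esub> eval_fpoly B \<phi> f"
    if "\<forall>i. \<phi> (Y i) \<in> deg0 B \<and> \<phi> (Z i) \<in> deg1 B" for \<phi> and f g :: "(gvar, 'f) fpoly"
    by (intro B.eval_closed B.eval_add B.eval_mult B.eval_neg phi[OF that])+
  have ic: "inv\<^bsub>add_monoid (free_alg X)\<^esub> f = - f" if "f \<in> carrier (free_alg X)" for f :: "(gvar, 'f) fpoly"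
    using that F.add.inv_equality[of "- f" f] by (simp add: free_alg_def a_inv_def)
  show ?thesis
  proof (rule idealI[OF F.ring_axioms])
    show "subgroup (carrier (free_alg X) \<inter> T_Z2 B) (add_monoid (free_alg X))"
    proof (rule subgroup.intro)
      fix f assume "f \<in> carrier (free_alg X) \<inter> T_Z2 B"
      then show "inv\<^bsub>add_monoid (free_alg X)\<^esub> f \<in> carrier (free_alg X) \<inter> T_Z2 B"
        using F.add.inv_closed[of f] ic[of f] by (auto simp: T_Z2_def ev a_inv_def)
    next
      fix f g :: "(gvar, 'f) fpoly"
      assume *: "f \<in> carrier (free_alg X) \<inter> T_Z2 B" "g \<in> carrier (free_alg X) \<inter> T_Z2 B"
      have "f \<oplus>\<^bsub>free_alg X\<^esub> g = f + g" by (simp add: free_alg_def)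
      then show "f \<otimes>\<^bsub>add_monoid (free_alg X)\<^esub> g \<in> carrier (free_alg X) \<inter> T_Z2 B"
        using * F.a_closed[of f g] by (auto simp: T_Z2_def ev)
    next
      have "\<zero>\<^bsub>free_alg X\<^esub> = (0 :: (gvar, 'f) fpoly)" by (simp add: free_alg_def)
      then show "\<one>\<^bsub>add_monoid (free_alg X)\<^esub> \<in> carrier (free_alg X) \<inter> T_Z2 B"
        using F.zero_closed by (auto simp: T_Z2_def eval_fpoly_def)
    qed auto
  next
    fix f g :: "(gvar, 'f) fpoly"
    assume *: "f \<in> carrier (free_alg X) \<inter> T_Z2 B" "g \<in> carrier (free_alg X)"
    have m: "f \<otimes>\<^bsub>free_alg X\<^esub> g = f * g" "g \<otimes>\<^bsub>free_alg X\<^esub> f = g * f" by (simp_all add: free_alg_def)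
    show "g \<otimes>\<^bsub>free_alg X\<^esub> f \<in> carrier (free_alg X) \<inter> T_Z2 B"
      using * F.m_closed[of g f] by (auto simp: T_Z2_def m ev)
    show "f \<otimes>\<^bsub>free_alg X\<^esub> g \<in> carrier (free_alg X) \<inter> T_Z2 B"
      using * F.m_closed[of f g] by (auto simp: T_Z2_def m ev)
  qed
qed

lemma f_algebra_grassmann: "f_algebra grassmann"
  unfolding grassmann_def by (intro f_algebra_quot_alg f_algebra_free_alg ideal_grassmann_ideal)

lemma grassmann_star_simps [simp]:
  "carrier (grassmann_star k) = carrier grassmann"
  "mult (grassmann_star k) = mult grassmann"
  "one (grassmann_star k) = one grassmann"
  "zero (grassmann_star k) = zero grassmann"
  "add (grassmann_star k) = add grassmann"
  "of_scalar (grassmann_star k) = of_scalar grassmann"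
  "deg0 (grassmann_star k) = star_component k 0"
  "deg1 (grassmann_star k) = star_component k 1"
  by (simp_all add: grassmann_star_def falgebra.defs z2_algebra.defs)

lemma f_algebra_grassmann_star: "f_algebra (grassmann_star k :: ('f::field, (nat, 'f) fpoly set) z2_algebra)"
proof -
  interpret G: f_algebra "grassmann :: ('f, (nat, 'f) fpoly set) falgebra" by (rule f_algebra_grassmann)
  have neg: "\<exists>y\<in>carrier grassmann. y \<oplus>\<^bsub>grassmann\<^esub> x = \<zero>\<^bsub>grassmann\<^esub>" if "x \<in> carrier grassmann" for x :: "(nat,'f) fpoly set"
    using that G.l_neg G.a_inv_closed by blast
  have "ring (grassmann_star k :: ('f, (nat,'f) fpoly set) z2_algebra)"
    by (intro ringI abelian_groupI monoidI)
      (simp_all add: neg G.l_distr G.r_distr G.m_assoc G.a_ac)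
  then show ?thesis
    by (intro f_algebra.intro f_algebra_axioms.intro)
      (simp_all only: grassmann_star_simps G.sc_closed G.sc_add G.sc_mult G.sc_one, rule G.sc_central)
qed

lemma star_component_subset:
  "star_component k d \<subseteq> carrier (grassmann :: ('f::field, (nat, 'f) fpoly set) falgebra)" (is "_ \<subseteq> carrier ?G")
proof -
  interpret G: f_algebra ?G by (rule f_algebra_grassmann)
  interpret I: ideal grassmann_ideal "free_alg {1..} :: ('f, (nat, 'f) fpoly) falgebra" by (rule ideal_grassmann_ideal)
  have mon: "grassmann_monom is \<in> carrier ?G" if "set is \<subseteq> {1..}" for "is"
    unfolding grassmann_monom_def grassmann_def quot_alg_simps
    using that by (intro ring_hom_closed[OF I.rcos_ring_hom]) (auto simp: free_alg_def fmonom_def split: if_splits)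
  have "scalars ?G \<subseteq> carrier ?G" by (auto simp: scalars_def)
  moreover have "set us \<subseteq> carrier ?G"
    if "us \<in> lists {grassmann_monom is | is. set is \<subseteq> {1..} \<and> P is}" for us P
    using that mon by (auto simp: in_lists_conv_set)
  ultimately show ?thesis
    unfolding star_component_def lin_span_def by (intro UN_least G.Span_in_carrier) 
qed

lemma f_algebra_rel_free: "f_algebra (rel_free_Z2 m (grassmann_star k))"
  unfolding rel_free_Z2_def free_alg_YZ_def
  by (rule f_algebra_quot_alg[OF f_algebra_free_alg ideal_T_Z2[OF f_algebra_grassmann_star]])
    (simp_all add: star_component_subset)

lemma lookup_mult_zero:
  fixes f g :: "('x, 'f::field) fpoly"
  shows "Poly_Mapping.lookup (f * g) 0 = Poly_Mapping.lookup f 0 * Poly_Mapping.lookup g 0"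
proof (induction f rule: poly_mapping_induct)
  case (single u a)
  show ?case
  proof (induction g rule: poly_mapping_induct)
    case (single v b)
    have "u + v = 0 \<longleftrightarrow> u = 0 \<and> v = 0"
      by (cases u; cases v) (simp add: zero_fword_def plus_fword_def)
    then show ?case by (auto simp: mult_single lookup_single when_def)
  qed (simp_all add: distrib_left lookup_add)
qed (simp_all add: distrib_right lookup_add)

lemma one_notin_grassmann_ideal: "1 \<notin> (grassmann_ideal :: (nat, 'f::field) fpoly set)"
proof -
  let ?F = "free_alg {1..} :: ('f, (nat, 'f) fpoly) falgebra"
  let ?J = "{f \<in> carrier ?F. Poly_Mapping.lookup f 0 = 0}"
  interpret F: ring ?F by (rule ring_free_alg)
  have ic: "inv\<^bsub>add_monoid ?F\<^esub> f = - f" if "f \<in> carrier ?F" for f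
    using that F.add.inv_equality[of "- f" f] by (simp add: free_alg_def a_inv_def)
  have "ideal ?J ?F"
  proof (rule idealI[OF F.ring_axioms])
    show "subgroup ?J (add_monoid ?F)"
    proof (rule subgroup.intro)
      fix f assume "f \<in> ?J"
      then show "inv\<^bsub>add_monoid ?F\<^esub> f \<in> ?J"
        using F.add.inv_closed[of f] ic[of f] by (auto simp: a_inv_def)
    next
      fix f g assume "f \<in> ?J" "g \<in> ?J"
      then show "f \<otimes>\<^bsub>add_monoid ?F\<^esub> g \<in> ?J"
        using F.a_closed[of f g] by (auto simp: free_alg_def lookup_add)
    qed (auto simp: free_alg_def)
  next
    fix f g assume "f \<in> ?J" "g \<in> carrier ?F"
    then show "g \<otimes>\<^bsub>?F\<^esub> f \<in> ?J" "f \<otimes>\<^bsub>?F\<^esub> g \<in> ?J"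
      using F.m_closed[of f g] F.m_closed[of g f] by (auto simp: free_alg_def lookup_mult_zero)
  qed
  moreover have "{fmonom [i, j] + fmonom [j, i] | i j. 1 \<le> i \<and> 1 \<le> j} \<subseteq> ?J"
    by (auto simp: free_alg_def fmonom_def lookup_add lookup_single when_def zero_fword_def
        dest!: subsetD[OF keys_add] split: if_splits)
  ultimately have "grassmann_ideal \<subseteq> ?J"
    unfolding grassmann_ideal_def by (rule F.genideal_minimal)
  then show ?thesis by (auto simp: lookup_one)
qed

lemma one_neq_zero_quot_alg:
  assumes "ideal I A" "\<one>\<^bsub>A\<^esub> \<notin> I"
  shows "\<one>\<^bsub>quot_alg A I\<^esub> \<noteq> \<zero>\<^bsub>quot_alg A I\<^esub>"
proof -
  interpret I: ideal I A by fact
  have "I +>\<^bsub>A\<^esub> \<one>\<^bsub>A\<^esub> \<noteq> I"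
    using I.a_rcos_self[of "\<one>\<^bsub>A\<^esub>"] assms(2) by auto
  then show ?thesis by (simp add: FactRing_def)
qed

lemma subfield_scalars_rel_free:
  fixes k m :: nat
  defines "B \<equiv> grassmann_star k :: ('f::field, (nat, 'f) fpoly set) z2_algebra"
  shows "subfield (scalars (rel_free_Z2 m B)) (rel_free_Z2 m B)"
proof -
  interpret R: f_algebra "rel_free_Z2 m B" unfolding B_def by (rule f_algebra_rel_free)
  interpret B: f_algebra B unfolding B_def by (rule f_algebra_grassmann_star)
  interpret G: f_algebra "grassmann :: ('f, (nat, 'f) fpoly set) falgebra"
    by (rule f_algebra_grassmann)
  have "\<one>\<^bsub>B\<^esub> \<noteq> \<zero>\<^bsub>B\<^esub>"
    unfolding B_def grassmann_star_simps unfolding grassmann_def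
    by (rule one_neq_zero_quot_alg[OF ideal_grassmann_ideal])
      (use one_notin_grassmann_ideal in \<open>simp add: free_alg_def\<close>)
  moreover have "eval_fpoly B (\<lambda>x. \<zero>\<^bsub>B\<^esub>) 1 = \<one>\<^bsub>B\<^esub>"
    using B.eval_single[of "\<lambda>x. \<zero>\<^bsub>B\<^esub>" 0 1] by (simp add: B.sc_one letters_zero list_prod_def)
  moreover have "\<zero>\<^bsub>B\<^esub> \<in> deg0 B" "\<zero>\<^bsub>B\<^esub> \<in> deg1 B"
    by (auto simp: B_def star_component_def lin_span_def intro!: bexI[of _ "[]"])
  ultimately have "1 \<notin> T_Z2 B"
    by (auto simp: T_Z2_def intro!: exI[of _ "\<lambda>x. \<zero>\<^bsub>B\<^esub>"])
  then have "\<one>\<^bsub>rel_free_Z2 m B\<^esub> \<noteq> \<zero>\<^bsub>rel_free_Z2 m B\<^esub>"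
    unfolding rel_free_Z2_def free_alg_YZ_def
    by (intro one_neq_zero_quot_alg ideal_T_Z2 B.f_algebra_axioms)
      (simp_all add: B_def star_component_subset, simp add: free_alg_def)
  then show ?thesis by (rule R.subfield_scalars)
qed

end

theory Submission
  imports Defs "HOL-Real_Asymp.Real_Asymp" "HOL-Computational_Algebra.Polynomial"
begin

text \<open>
  Write \<open>R\<close> for the relatively free algebra and \<open>T\<close> for the ideal of graded identities of the
  Grassmann algebra \<open>E\<close> with its star grading. Three facts about \<open>E\<close> decide the dimension.

  In characteristic different from \<open>2\<close>, two words in the generators commute up to a sign, so that a
  commutator of words is either \<open>0\<close> or twice a word of even length, hence central: \<open>T\<close> contains every
  \<open>[[f, g], h]\<close> (\<open>star_lie_nilpotent\<close>). Consequently \<open>[f, g]\<^sup>2\<close> lies in \<open>T\<close> as well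
  (\<open>comm_square\<close>), and only finitely many products of commutators of variables survive in \<open>R\<close>.
  Finally, every basis monomial of odd degree contains one of \<open>e\<^sub>1, \<dots>, e\<^sub>k\<close>, each of which can occur at
  most once in a nonzero word, so that a word with more than \<open>k\<close> odd variables vanishes on \<open>E\<close>
  (\<open>star_nilpotent_letter\<close>).

  Upper bound: exchanging two adjacent letters of a word costs a commutator, which is central and
  multiplies a word that is shorter by two letters. By induction on the length, \<open>R\<close> is spanned by
  products \<open>y\<^sub>1\<^bsup>a1\<^esup> \<cdots> y\<^sub>m\<^bsup>am\<^esup> z\<^sub>1\<^bsup>b1\<^esup> \<cdots> z\<^sub>m\<^bsup>bm\<^esup> c\<close> with every \<open>bj \<le> k\<close> and \<open>c\<close> from a finite set
  (\<open>words_normal_form\<close>). Only the \<open>m\<close> exponents of the even variables are unbounded, so that words of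
  length at most \<open>n\<close> span a space of dimension at most \<open>C (n + 1)\<^sup>m\<close>
  (\<open>polynomially_filtered_quotient\<close>), which forces the Gelfand--Kirillov dimension down to \<open>m\<close>.

  Lower bound: the scalars are even elements of \<open>E\<close>, so a linear relation between the monomials
  \<open>y\<^sub>1\<^bsup>a1\<^esup> \<cdots> y\<^sub>m\<^bsup>am\<^esup>\<close> in \<open>R\<close> is a polynomial function vanishing on all of \<open>F\<^sup>m\<close>. As \<open>F\<close> is infinite, Kronecker
  substitution \<open>y\<^sub>j \<mapsto> t\<^bsup>q^(j-1)\<^esup>\<close> shows that the \<open>q\<^sup>m\<close> monomials with exponents below \<open>q\<close> are independent
  (\<open>kronecker_words_independent\<close>); they have length at most \<open>m q\<close>, so the growth is at least of
  degree \<open>m\<close>.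
\<close>

section \<open>Polynomial growth of filtered algebras\<close>

lemma limsup_log_growth_le:
  fixes d :: nat and C :: nat and f :: "nat \<Rightarrow> nat"
  assumes "\<And>n. f n \<le> C * (s * n + 1) ^ d"
  shows "limsup (\<lambda>n. ereal (log (real n) (real (f n)))) \<le> ereal (real d)"
proof -
  let ?g = "\<lambda>n. log (real n) (real (C + 1) * (real s * real n + 1) ^ d)"
  have "limsup (\<lambda>n. ereal (log (real n) (real (f n)))) \<le> limsup (\<lambda>n. ereal (?g n))"
  proof (rule Limsup_mono)
    \<comment> \<open>The constant \<open>C + 1\<close> instead of \<open>C\<close> keeps the bound at least \<open>1\<close>, so that its logarithm is not below \<open>log n 0 = 0\<close>.\<close>
    have "log (real n) (real (f n)) \<le> ?g n" if "n \<ge> 2" for n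
    proof -
      have "real (f n) \<le> real (C * (s * n + 1) ^ d)"
        using assms[of n] by (simp only: of_nat_le_iff)
      also have "\<dots> \<le> real (C + 1) * (real s * real n + 1) ^ d"
        by (simp add: add_ac mult_right_mono)
      finally have le: "real (f n) \<le> real (C + 1) * (real s * real n + 1) ^ d" .
      have ge: "1 \<le> real (C + 1) * (real s * real n + 1) ^ d"
        using mult_mono[of 1 "real (C + 1)" 1 "(real s * real n + 1) ^ d"] by (simp add: one_le_power)
      show ?thesis
      proof (cases "f n = 0")
        case True
        then show ?thesis using that ge by (simp add: log_def)
      next
        case False
        then show ?thesis using that le by (intro log_mono) auto
      qed
    qed
    then show "\<forall>\<^sub>F n in sequentially. ereal (log (real n) (real (f n))) \<le> ereal (?g n)"
      by (auto intro: eventually_sequentiallyI[of 2])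
  qed
  also have "limsup (\<lambda>n. ereal (?g n)) \<le> limsup (\<lambda>n. ereal (log (real n) (real (C + 1) * (real (s + 1) * real n) ^ d)))"
  proof (rule Limsup_mono)
    have "?g n \<le> log (real n) (real (C + 1) * (real (s + 1) * real n) ^ d)" if "n \<ge> 2" for n
    proof -
      have "(real s * real n + 1) ^ d \<le> (real (s + 1) * real n) ^ d"
        using that by (intro power_mono) (auto simp: algebra_simps)
      moreover have "0 < (real s * real n + 1) ^ d"
        by (intro zero_less_power) (simp add: add_nonneg_pos)
      ultimately show ?thesis using that by (intro log_mono) (auto intro!: mult_pos_pos mult_left_mono)
    qed
    then show "\<forall>\<^sub>F n in sequentially. ereal (?g n) \<le> ereal (log (real n) (real (C + 1) * (real (s + 1) * real n) ^ d))"
      by (auto intro: eventually_sequentiallyI[of 2])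
  qed
  also have "\<dots> = ereal (real d)"
  proof (intro lim_imp_Limsup)
    have eq: "log (real n) (real (C + 1) * (real (s + 1) * real n) ^ d) =
        ln (real (C + 1) * real (s + 1) ^ d) / ln (real n) + real d" if "n \<ge> 2" for n
    proof -
      have "ln (real (C + 1) * (real (s + 1) * real n) ^ d) =
          ln (real (C + 1) * real (s + 1) ^ d) + real d * ln (real n)"
        using that by (simp add: power_mult_distrib ln_mult ln_realpow)
      moreover have "ln (real n) > 0" using that by simp
      ultimately show ?thesis by (simp add: log_def add_divide_distrib)
    qed
    have "(\<lambda>n. ln (real (C + 1) * real (s + 1) ^ d) / ln (real n) + real d) \<longlonglongrightarrow> real d"
      by real_asymp
    then have "(\<lambda>n. log (real n) (real (C + 1) * (real (s + 1) * real n) ^ d)) \<longlonglongrightarrow> real d"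
      by (rule Lim_transform_eventually) (use eq in \<open>auto intro!: eventually_sequentiallyI[of 2]\<close>)
    then show "(\<lambda>n. ereal (log (real n) (real (C + 1) * (real (s + 1) * real n) ^ d))) \<longlonglongrightarrow> ereal (real d)"
      by simp
  qed simp
  finally show ?thesis .
qed

lemma limsup_log_growth_ge:
  fixes d :: nat and f :: "nat \<Rightarrow> nat"
  assumes d: "d \<ge> 1" and f: "\<And>n. (n div d) ^ d \<le> f n"
  shows "ereal (real d) \<le> limsup (\<lambda>n. ereal (log (real n) (real (f n))))"
proof -
  let ?g = "\<lambda>n. real d * (1 - ln (2 * real d) / ln (real n))"
  have "?g \<longlonglongrightarrow> real d"
    by real_asymp
  then have "ereal (real d) = limsup (\<lambda>n. ereal (?g n))"
    by (intro lim_imp_Limsup[symmetric]) auto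
  also have "\<dots> \<le> limsup (\<lambda>n. ereal (log (real n) (real (f n))))"
  proof (rule Limsup_mono)
    have "?g n \<le> log (real n) (real (f n))" if n: "n \<ge> 2 * d" for n
    proof -
      have "d * (n div d) + n mod d = n" "n mod d < d" using d by auto
      \<comment> \<open>For \<open>n \<ge> 2 d\<close> the rounding in \<open>n div d\<close> costs at most a factor \<open>2\<close>.\<close>
      then have "n \<le> 2 * (d * (n div d))" using n by linarith
      then have "real n \<le> real (2 * (d * (n div d)))" by (simp only: of_nat_le_iff)
      then have "real n / (2 * real d) \<le> real (n div d)"
        using d by (simp add: field_simps)
      then have "(real n / (2 * real d)) ^ d \<le> real (n div d) ^ d"
        by (intro power_mono) auto
      also have "\<dots> \<le> real (f n)"
        using f[of n] by (simp only: of_nat_le_iff flip: of_nat_power)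
      finally have le: "(real n / (2 * real d)) ^ d \<le> real (f n)" .
      have "n \<ge> 2" using n d by simp
      have "?g n = log (real n) ((real n / (2 * real d)) ^ d)"
      proof -
        have "ln ((real n / (2 * real d)) ^ d) = real d * (ln (real n) - ln (2 * real d))"
          using \<open>n \<ge> 2\<close> d ln_realpow[of "real n / (2 * real d)" d] ln_div[of "real n" "2 * real d"] by simp
        moreover have "ln (real n) > 0" using \<open>n \<ge> 2\<close> by simp
        ultimately show ?thesis by (simp add: log_def diff_divide_distrib right_diff_distrib)
      qed
      also have "\<dots> \<le> log (real n) (real (f n))"
        using \<open>n \<ge> 2\<close> d le by (intro log_mono) auto
      finally show ?thesis .
    qed
    then show "\<forall>\<^sub>F n in sequentially. ereal (?g n) \<le> ereal (log (real n) (real (f n)))"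
      by (auto intro: eventually_sequentiallyI[of "2 * d"])
  qed
  finally show ?thesis .
qed

text \<open>
  An exhaustive multiplicative filtration whose \<open>n\<close>-th piece has dimension \<open>O(n\<^sup>d)\<close>. The dimension is
  bounded through a spanning list, so that no independence has to be established to exhibit a filtration.
\<close>

definition polynomially_filtered :: "('f::field, 'a, 'm) falgebra_scheme \<Rightarrow> nat \<Rightarrow> bool" where
  "polynomially_filtered A d \<longleftrightarrow> (\<exists>F C.
     (\<forall>n. subalgebra (scalars A) (F n) A) \<and> \<one>\<^bsub>A\<^esub> \<in> F 0 \<and> (\<forall>i j. i \<le> j \<longrightarrow> F i \<subseteq> F j) \<and>
     (\<forall>i j. \<forall>x\<in>F i. \<forall>y\<in>F j. x \<otimes>\<^bsub>A\<^esub> y \<in> F (i + j)) \<and> carrier A \<subseteq> (\<Union>n. F n) \<and>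
     (\<forall>n. \<exists>us. set us \<subseteq> carrier A \<and> length us \<le> C * (n + 1) ^ d \<and>
        F n \<subseteq> ring.Span A (scalars A) us))"

context f_algebra
begin

lemma subalgebraI:
  assumes "W \<subseteq> carrier A" "\<zero> \<in> W" "\<And>x y. x \<in> W \<Longrightarrow> y \<in> W \<Longrightarrow> x \<oplus> y \<in> W"
    and smult: "\<And>c x. x \<in> W \<Longrightarrow> of_scalar A c \<otimes> x \<in> W"
  shows "subalgebra (scalars A) W A"
proof (rule subalgebra.intro)
  show "subgroup W (add_monoid A)"
  proof (rule add.subgroupI)
    show "\<ominus> x \<in> W" if x: "x \<in> W" for x
    proof -
      have xc: "x \<in> carrier A" using x assms(1) by blast
      have "of_scalar A (- 1) \<otimes> x \<oplus> x = (of_scalar A (- 1) \<oplus> of_scalar A 1) \<otimes> x"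
        using xc by (simp add: sc_one l_distr)
      also have "\<dots> = \<zero>" using xc by (simp add: sc_zero flip: sc_add)
      finally show ?thesis using smult[OF x, of "- 1"] xc by (simp add: minus_equality)
    qed
  qed (use assms in auto)
  show "subalgebra_axioms (scalars A) W A"
    using smult by (auto simp: subalgebra_axioms_def scalars_def)
qed

context
  assumes one_neq_zero: "\<one> \<noteq> \<zero>"
begin

lemma scalars_subfield: "subfield (scalars A) A"
  by (rule subfield_scalars[OF one_neq_zero])

lemma subalgebra_lin_span:
  assumes S: "S \<subseteq> carrier A"
  shows "subalgebra (scalars A) (lin_span A S) A"
proof -
  have car: "set us \<subseteq> carrier A" if "us \<in> lists S" for us
    using that S by auto
  note props = Span_subgroup_props[OF scalars_subfield car]
  have "subgroup (lin_span A S) (add_monoid A)"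
  proof (rule add.subgroupI)
    show "lin_span A S \<subseteq> carrier A"
      using props(1) by (auto simp: lin_span_def)
    have "\<zero> \<in> lin_span A S"
      using props(2)[of "[]"] unfolding lin_span_def by blast
    then show "lin_span A S \<noteq> {}" by blast
    show "\<ominus> x \<in> lin_span A S" if "x \<in> lin_span A S" for x
    proof -
      obtain us where us: "us \<in> lists S" "x \<in> Span (scalars A) us"
        using \<open>x \<in> lin_span A S\<close> unfolding lin_span_def by auto
      then have "\<ominus> x \<in> Span (scalars A) us" by (intro props(4))
      then show ?thesis using us(1) unfolding lin_span_def by blast
    qed
    show "x \<oplus> y \<in> lin_span A S" if xy: "x \<in> lin_span A S" "y \<in> lin_span A S" for x y
    proof -
      obtain us vs where us: "us \<in> lists S" "x \<in> Span (scalars A) us"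
        and vs: "vs \<in> lists S" "y \<in> Span (scalars A) vs"
        using xy unfolding lin_span_def by auto
      have "x \<in> Span (scalars A) (us @ vs)" "y \<in> Span (scalars A) (us @ vs)"
        using us(2) vs(2) mono_Span_append[OF scalars_subfield car[OF us(1)] car[OF vs(1)]]
          mono_Span_append[OF scalars_subfield car[OF vs(1)] car[OF us(1)]]
        by (auto simp del: Span.simps)
      moreover have "us @ vs \<in> lists S" using us vs by simp
      ultimately show ?thesis
        using props(3)[of "us @ vs"] unfolding lin_span_def by blast
    qed
  qed
  then show ?thesis
  proof (rule subalgebra.intro)
    have "k \<otimes> v \<in> lin_span A S" if "k \<in> scalars A" "v \<in> lin_span A S" for k v
      using that Span_smult_closed[OF scalars_subfield car] unfolding lin_span_def by blast
    then show "subalgebra_axioms (scalars A) (lin_span A S) A"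
      by (simp add: subalgebra_axioms_def)
  qed
qed

lemma lin_span_superset:
  assumes "S \<subseteq> carrier A" shows "S \<subseteq> lin_span A S"
proof
  fix x assume "x \<in> S"
  then show "x \<in> lin_span A S"
    using Span_base_incl[OF scalars_subfield, of "[x]"] assms
    by (auto simp: lin_span_def intro!: bexI[of _ "[x]"])
qed

lemma lin_span_least:
  assumes "subalgebra (scalars A) W A" "S \<subseteq> W" shows "lin_span A S \<subseteq> W"
  unfolding lin_span_def
  using assms by (intro UN_least subalgebra_Span_incl[OF scalars_subfield]) auto

text \<open>
  A spanning list can be thinned out to a basis: a vector either enlarges the span of the later ones
  by one dimension or leaves it unchanged.
\<close>

lemma dimension_Span_le_length:
  assumes "set us \<subseteq> carrier A"
  shows "\<exists>n \<le> length us. dimension n (scalars A) (Span (scalars A) us)"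
  using assms
proof (induction us)
  case (Cons u us)
  then obtain n where n: "n \<le> length us" "dimension n (scalars A) (Span (scalars A) us)"
    by auto
  show ?case
  proof (cases "u \<in> Span (scalars A) us")
    case True
    have "Span (scalars A) (u # us) = Span (scalars A) us"
    proof (rule equalityI)
      have "set (u # us) \<subseteq> Span (scalars A) us"
        using Cons.prems True Span_base_incl[OF scalars_subfield, of us]
        by (simp del: Span.simps)
      then show "Span (scalars A) (u # us) \<subseteq> Span (scalars A) us"
        using Cons.prems by (intro mono_Span_subset[OF scalars_subfield]) auto
      show "Span (scalars A) us \<subseteq> Span (scalars A) (u # us)"
        using Cons.prems by (intro mono_Span[OF scalars_subfield]) auto
    qed
    then show ?thesis using n by (auto intro: exI[of _ n])
  next
    case False
    then show ?thesis
      using n Cons.prems Suc_dim[of u "Span (scalars A) us" n "scalars A"]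
      by (auto intro!: exI[of _ "Suc n"])
  qed
qed auto

lemma subspace_of_Span:
  assumes E: "subalgebra (scalars A) E A" and us: "set us \<subseteq> carrier A"
    and sub: "E \<subseteq> Span (scalars A) us"
  shows "finite_dimension (scalars A) E" and "dim (scalars A) E \<le> length us"
proof -
  obtain n where n: "n \<le> length us" "dimension n (scalars A) (Span (scalars A) us)"
    using dimension_Span_le_length[OF us] by blast
  show fin: "finite_dimension (scalars A) E"
    using subalbegra_incl_imp_finite_dimension[OF scalars_subfield _ E sub]
      Span_finite_dimension[OF scalars_subfield us] by blast
  then obtain d where d: "dimension d (scalars A) E"
    by (auto simp: finite_dimension_def)
  obtain vs where vs: "independent (scalars A) vs" "length vs = d" "Span (scalars A) vs = E"
    "set vs \<subseteq> carrier A"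
    using exists_base[OF scalars_subfield d] by blast
  have "set vs \<subseteq> E"
    using Span_base_incl[OF scalars_subfield vs(4)] vs(3) by simp
  then have "d \<le> n"
    using independent_length_le_dimension[OF scalars_subfield n(2) vs(1)] sub vs(2) by auto
  moreover have "dim (scalars A) E = d"
    using dimI[OF scalars_subfield d] by (simp add: over_def)
  ultimately show "dim (scalars A) E \<le> length us"
    using n by simp
qed

lemma list_prods_closed:
  "V \<subseteq> carrier A \<Longrightarrow> list_prod A ` {vs \<in> lists V. length vs \<le> n} \<subseteq> carrier A"
  using list_prod_closed by blast

lemma power_sum_subspace:
  "V \<subseteq> carrier A \<Longrightarrow> subalgebra (scalars A) (power_sum A V n) A"
  unfolding power_sum_def by (intro subalgebra_lin_span list_prods_closed)

text \<open>
  A finite-dimensional \<open>V\<close> is contained in some piece \<open>F s\<close>, hence products of at most \<open>n\<close> elements of \<open>V\<close>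
  are contained in \<open>F (s n)\<close>. Replacing \<open>n\<close> by \<open>s n\<close> does not change the degree of the growth, which is
  why one filtration controls all \<open>V\<close> at once.
\<close>

lemma power_sum_growth:
  assumes filt: "polynomially_filtered A d" and V: "finite_dimension (scalars A) V"
  shows "finite_dimension (scalars A) (power_sum A V n)"
    and "\<exists>C s. \<forall>n. dim (scalars A) (power_sum A V n) \<le> C * (s * n + 1) ^ d"
proof -
  obtain F C where F_subspace: "\<And>n. subalgebra (scalars A) (F n) A"
    and F_one: "\<one> \<in> F 0"
    and F_mono: "\<And>i j. i \<le> j \<Longrightarrow> F i \<subseteq> F j"
    and F_mult: "\<And>i j x y. x \<in> F i \<Longrightarrow> y \<in> F j \<Longrightarrow> x \<otimes> y \<in> F (i + j)"
    and F_exhausts: "carrier A \<subseteq> (\<Union>n. F n)"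
    and F_spanned: "\<And>n. \<exists>us. set us \<subseteq> carrier A \<and> length us \<le> C * (n + 1) ^ d \<and>
      F n \<subseteq> Span (scalars A) us"
    using filt unfolding polynomially_filtered_def by (elim exE conjE) (rule that; blast)
  obtain vs where vs: "set vs \<subseteq> carrier A" "Span (scalars A) vs = V"
    using V exists_base[OF scalars_subfield] by (auto simp: finite_dimension_def)
  have Vc: "V \<subseteq> carrier A" using Span_subgroup_props(1)[OF scalars_subfield vs(1)] vs(2) by simp
  have "\<exists>s. set ws \<subseteq> F s" if "set ws \<subseteq> carrier A" for ws
    using that
  proof (induction ws)
    case (Cons w ws)
    then obtain s t where "set ws \<subseteq> F s" "w \<in> F t" using F_exhausts by auto
    then have "set (w # ws) \<subseteq> F (max s t)"
      using F_mono[of s "max s t"] F_mono[of t "max s t"] by auto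
    then show ?case by blast
  qed auto
  then obtain s where "set vs \<subseteq> F s" using vs by blast
  then have VF: "V \<subseteq> F s"
    using subalgebra_Span_incl[OF scalars_subfield F_subspace] vs(2) by blast
  have prods: "list_prod A ws \<in> F (s * length ws)" if "set ws \<subseteq> V" for ws
    using that F_one VF
    by (induction ws) (auto simp: list_prod_def intro!: F_mult)
  have sub: "power_sum A V n \<subseteq> F (s * n)" for n
    unfolding power_sum_def
  proof (intro lin_span_least F_subspace image_subsetI)
    fix ws assume "ws \<in> {vs \<in> lists V. length vs \<le> n}"
    then show "list_prod A ws \<in> F (s * n)"
      using prods[of ws] F_mono[of "s * length ws" "s * n"] by auto
  qed
  obtain us where us: "\<And>n. set (us n) \<subseteq> carrier A" "\<And>n. length (us n) \<le> C * (n + 1) ^ d"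
    "\<And>n. F n \<subseteq> Span (scalars A) (us n)"
    using F_spanned by metis
  have sp: "power_sum A V n \<subseteq> Span (scalars A) (us (s * n))" for n
    using sub us(3) by blast
  show "finite_dimension (scalars A) (power_sum A V n)"
    by (rule subspace_of_Span(1)[OF power_sum_subspace[OF Vc] us(1) sp])
  show "\<exists>C s. \<forall>n. dim (scalars A) (power_sum A V n) \<le> C * (s * n + 1) ^ d"
    using subspace_of_Span(2)[OF power_sum_subspace[OF Vc] us(1) sp] us(2)
    by (meson order_trans)
qed

lemma GKdim_le_of_filtered:
  assumes "polynomially_filtered A d"
  shows "GKdim A \<le> ereal (real d)"
  unfolding GKdim_def
proof (rule SUP_least)
  fix V assume "V \<in> {V. finite_dimension (scalars A) V}"
  then obtain C s where "\<And>n. dim (scalars A) (power_sum A V n) \<le> C * (s * n + 1) ^ d"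
    using power_sum_growth(2)[OF assms] by blast
  then show "limsup (\<lambda>n. ereal (log (real n) (real (dim (scalars A) (power_sum A V n))))) \<le> ereal (real d)"
    by (rule limsup_log_growth_le)
qed

text \<open>
  The filtration enters only to make the spaces \<^const>\<open>power_sum\<close> finite-dimensional; without that,
  \<^const>\<open>ring.dim\<close> would carry no information about them. The value \<open>q = n div d\<close> turns the lists
  into a lower bound at every \<open>n\<close>.
\<close>

lemma GKdim_ge_of_independent:
  assumes filt: "polynomially_filtered A d" and d: "d \<ge> 1" and V: "finite_dimension (scalars A) V"
    and ind: "\<And>q. independent (scalars A) (bs q)" "\<And>q. length (bs q) = q ^ d"
    and sub: "\<And>q. set (bs q) \<subseteq> list_prod A ` {vs \<in> lists V. length vs \<le> d * q}"
  shows "ereal (real d) \<le> GKdim A"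
proof -
  have Vc: "V \<subseteq> carrier A"
    using finite_dimension_imp_subalgebra[OF scalars_subfield V] subalgebra_in_carrier by blast
  have "(n div d) ^ d \<le> dim (scalars A) (power_sum A V n)" for n
  proof -
    have "set (bs (n div d)) \<subseteq> list_prod A ` {vs \<in> lists V. length vs \<le> n}"
      using sub[of "n div d"] times_div_less_eq_dividend[of d n] by (blast intro: order_trans)
    also have "\<dots> \<subseteq> power_sum A V n"
      unfolding power_sum_def by (rule lin_span_superset[OF list_prods_closed[OF Vc]])
    finally have "length (bs (n div d)) \<le> dim (scalars A) (power_sum A V n)"
      using independent_length_le_dimension[OF scalars_subfield
        finite_dimensionE[OF scalars_subfield power_sum_growth(1)[OF filt V]] ind(1)]
      by (simp add: over_def)
    then show ?thesis using ind(2) by simp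
  qed
  then have "ereal (real d) \<le> limsup (\<lambda>n. ereal (log (real n) (real (dim (scalars A) (power_sum A V n)))))"
    by (rule limsup_log_growth_ge[OF d])
  also have "\<dots> \<le> GKdim A"
    unfolding GKdim_def using V by (intro SUP_upper) simp
  finally show ?thesis .
qed

end

end

section \<open>Words modulo an ideal containing all triple commutators\<close>

definition gen :: "'x \<Rightarrow> ('x, 'f::field) fpoly" where
  "gen x = fmonom [x]"

definition scale_fpoly :: "'f::field \<Rightarrow> ('x, 'f) fpoly \<Rightarrow> ('x, 'f) fpoly" where
  "scale_fpoly c f = Poly_Mapping.single 0 c * f"

abbreviation commutator :: "'r::ring \<Rightarrow> 'r \<Rightarrow> 'r" where
  "commutator f g \<equiv> f * g - g * f"

text \<open>
  Spans and subspaces of free algebras are taken in the sense of vector spaces over the coefficient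
  field; they are compared with spans in a quotient algebra only after normal forms are available.
\<close>

interpretation fpoly: vector_space "scale_fpoly :: 'f::field \<Rightarrow> ('x, 'f) fpoly \<Rightarrow> _"
  by unfold_locales
     (simp_all add: scale_fpoly_def algebra_simps single_add mult_single flip: mult.assoc)

lemma fmonom_Nil [simp]: "fmonom [] = 1"
  by (simp add: fmonom_def zero_fword_def[symmetric])

lemma fmonom_append: "fmonom (u @ v) = fmonom u * fmonom v"
  by (simp add: fmonom_def mult_single plus_fword_def)

lemma fmonom_Cons: "fmonom (x # v) = gen x * fmonom v"
  using fmonom_append[of "[x]" v] by (simp add: gen_def)

lemma scalar_central: "Poly_Mapping.single 0 c * f = f * Poly_Mapping.single (0 :: 'x fword) (c::'f::field)"
proof (induction f rule: poly_mapping_induct)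
  case (sum f g) then show ?case by (simp add: algebra_simps)
qed (simp_all add: mult_single mult.commute)

lemma fpoly_eq_sum_words:
  "f = (\<Sum>w\<in>Poly_Mapping.keys f. scale_fpoly (Poly_Mapping.lookup f w) (fmonom (letters w)))"
proof -
  have "(\<Sum>w\<in>Poly_Mapping.keys f. scale_fpoly (Poly_Mapping.lookup f w) (fmonom (letters w)))
     = (\<Sum>w\<in>Poly_Mapping.keys f. Poly_Mapping.single w (Poly_Mapping.lookup f w))"
    by (simp add: scale_fpoly_def fmonom_def mult_single)
  also have "\<dots> = f"
    by (rule poly_mapping_eqI)
       (auto simp: lookup_sum lookup_single when_def in_keys_iff)
  finally show ?thesis by simp
qed

text \<open>
  The principle by which linear statements about polynomials reduce to words.
\<close>

lemma fpoly_in_span_words: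
  assumes "\<And>w. w \<in> Poly_Mapping.keys f \<Longrightarrow> fmonom (letters w) \<in> S" "fpoly.subspace S"
  shows "f \<in> S"
  by (subst fpoly_eq_sum_words)
     (use assms in \<open>auto intro!: fpoly.subspace_sum fpoly.subspace_scale\<close>)

lemma subspace_halve:
  fixes f :: "('x, 'f::field) fpoly"
  assumes "fpoly.subspace S" "(2::'f) \<noteq> 0" "f + f \<in> S"
  shows "f \<in> S"
proof -
  have half: "1 / 2 + 1 / 2 = (1::'f)"
    using assms(2) by (simp add: field_simps)
  have "scale_fpoly (1 / 2) (f + f) = scale_fpoly (1 / 2 + 1 / 2) f"
    by (simp only: fpoly.scale_left_distrib fpoly.scale_right_distrib)
  then have "scale_fpoly (1 / 2) (f + f) = f"
    by (simp only: half fpoly.scale_one)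
  then show ?thesis
    using fpoly.subspace_scale[OF assms(1,3), of "1 / 2"] by simp
qed

text \<open>
  The list \<open>xs\<close> fixes the order of the letters, so that the letters themselves need not be ordered.
\<close>

definition sorted_word :: "'x list \<Rightarrow> ('x \<Rightarrow> nat) \<Rightarrow> 'x list" where
  "sorted_word xs \<alpha> = concat (map (\<lambda>x. replicate (\<alpha> x) x) xs)"

lemma count_sorted_word:
  "distinct xs \<Longrightarrow> count (mset (sorted_word xs \<alpha>)) x = (if x \<in> set xs then \<alpha> x else 0)"
  by (induction xs) (auto simp: sorted_word_def)

lemma mset_sorted_word:
  assumes "distinct xs" "set w \<subseteq> set xs" "\<And>x. x \<in> set xs \<Longrightarrow> \<alpha> x = count (mset w) x"
  shows "mset (sorted_word xs \<alpha>) = mset w"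
  using assms by (intro multiset_eqI) (auto simp: count_sorted_word count_eq_zero_iff)

definition com_prod :: "('x \<times> 'x) list \<Rightarrow> ('x, 'f::field) fpoly" where
  "com_prod ps = prod_list (map (\<lambda>(x, y). commutator (gen x) (gen y)) ps)"

text \<open>
  Commutators are central modulo \<open>T\<close>. The factor \<open>2\<close> has to be invertible for squares of commutators to
  lie in \<open>T\<close>.
\<close>

locale lie_nilpotent_ideal =
  fixes T :: "('x, 'f::field) fpoly set"
  assumes T_zero: "0 \<in> T"
    and T_add: "f \<in> T \<Longrightarrow> g \<in> T \<Longrightarrow> f + g \<in> T"
    and T_left: "f \<in> T \<Longrightarrow> g * f \<in> T"
    and T_right: "f \<in> T \<Longrightarrow> f * g \<in> T"
    and T_comm: "commutator (commutator f g) h \<in> T"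
    and two_neq_zero: "(2::'f) \<noteq> 0"
begin

lemma T_subspace: "fpoly.subspace T"
  unfolding fpoly.subspace_def scale_fpoly_def using T_zero T_add T_left by blast

lemmas T_diff = fpoly.subspace_diff[OF T_subspace]

text \<open>
  Expanding \<open>[f f, g] = f [f, g] + [f, g] f\<close> and taking the commutator with \<open>g\<close> once more gives, up to
  triple commutators, \<open>2 [f, g]\<^sup>2\<close>.
\<close>

lemma comm_square: "commutator f g * commutator f g \<in> T"
proof -
  have "commutator (commutator (f * f) g) g - f * commutator (commutator f g) g - commutator (commutator f g) g * f
      = commutator f g * commutator f g + commutator f g * commutator f g"
    by (simp add: algebra_simps)
  moreover have "commutator (commutator (f * f) g) g - f * commutator (commutator f g) g - commutator (commutator f g) g * f \<in> T"
    by (intro T_diff T_left T_right T_comm)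
  ultimately show ?thesis using subspace_halve[OF T_subspace two_neq_zero] by metis
qed

lemma comm_square_far: "commutator f g * h * commutator f g \<in> T"
proof -
  have "commutator f g * h * commutator f g = commutator (commutator f g) h * commutator f g + h * (commutator f g * commutator f g)"
    by (simp add: algebra_simps)
  then show ?thesis using T_add T_left T_right T_comm comm_square by metis
qed

text \<open>
  Two equal commutators in a product can be brought together because they are central. Hence finitely
  many products of commutators suffice, which is where the finiteness of the constant in the growth
  bound comes from.
\<close>

lemma com_prod_not_distinct:
  assumes "\<not> distinct ps" shows "com_prod ps \<in> T"
proof -
  obtain as bs cs p where "ps = as @ [p] @ bs @ [p] @ cs"
    using assms not_distinct_decomp by blast
  moreover obtain x y where "p = (x, y)" by (cases p)
  ultimately have "com_prod ps = com_prod as * (commutator (gen x) (gen y) * com_prod bs * commutator (gen x) (gen y)) * com_prod cs"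
    by (simp add: com_prod_def mult.assoc)
  then show ?thesis using comm_square_far T_left T_right by metis
qed

text \<open>
  The inductive step of the reduction: \<open>S\<close> contains \<open>T\<close> and all products of commutators with words
  shorter than \<open>L\<close>. Then words of length \<open>L\<close> can be permuted freely modulo \<open>S\<close>, first by one exchange of
  neighbours, then by moving one letter through a block, then arbitrarily. The prefix \<open>p\<close> carries the part of
  the word that is already in place.
\<close>

context
  fixes S :: "('x, 'f) fpoly set" and xs :: "'x list" and L :: nat
  assumes S: "fpoly.subspace S" and TS: "T \<subseteq> S"
    and shorter: "\<And>u ps. length u < L \<Longrightarrow> set u \<subseteq> set xs \<Longrightarrow> set ps \<subseteq> set xs \<times> set xs
      \<Longrightarrow> fmonom u * com_prod ps \<in> S"
begin

lemma swap_mod_S: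
  assumes "length (p @ x # y # q) = L" "set (p @ x # y # q) \<subseteq> set xs" "set ps \<subseteq> set xs \<times> set xs"
  shows "fmonom (p @ x # y # q) * com_prod ps - fmonom (p @ y # x # q) * com_prod ps \<in> S"
proof -
  let ?c = "commutator (gen x) (gen y) :: ('x, 'f) fpoly"
  \<comment> \<open>The commutator left over by the exchange moves past \<open>q\<close> and joins \<open>com_prod ps\<close>.\<close>
  have "fmonom (p @ x # y # q) * com_prod ps - fmonom (p @ y # x # q) * com_prod ps
      = fmonom p * (commutator ?c (fmonom q)) * com_prod ps + fmonom (p @ q) * com_prod ((x, y) # ps)"
    by (simp add: fmonom_append fmonom_Cons com_prod_def algebra_simps)
  moreover have "fmonom (p @ q) * com_prod ((x, y) # ps) \<in> S"
    using assms by (intro shorter) auto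
  moreover have "fmonom p * (commutator ?c (fmonom q)) * com_prod ps \<in> S"
    using TS T_left T_right T_comm by blast
  ultimately show ?thesis using fpoly.subspace_add[OF S] by metis
qed

lemma S_diff_trans: "f - g \<in> S \<Longrightarrow> g - h \<in> S \<Longrightarrow> f - h \<in> S"
  using fpoly.subspace_add[OF S, of "f - g" "g - h"] by simp

lemma move_mod_S:
  assumes "length (p @ x # a @ b) = L" "set (p @ x # a @ b) \<subseteq> set xs" "set ps \<subseteq> set xs \<times> set xs"
  shows "fmonom (p @ x # a @ b) * com_prod ps - fmonom (p @ a @ x # b) * com_prod ps \<in> S"
  using assms
proof (induction a arbitrary: p)
  case Nil then show ?case using fpoly.subspace_0[OF S] by simp
next
  case (Cons y a)
  have "fmonom (p @ x # y # (a @ b)) * com_prod ps - fmonom (p @ y # x # (a @ b)) * com_prod ps \<in> S"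
    using Cons.prems by (intro swap_mod_S) auto
  moreover have "fmonom ((p @ [y]) @ x # a @ b) * com_prod ps - fmonom ((p @ [y]) @ a @ x # b) * com_prod ps \<in> S"
    using Cons.prems by (intro Cons.IH) auto
  ultimately show ?case using S_diff_trans by simp
qed

lemma permute_mod_S:
  assumes "mset u = mset v" "length (p @ u) = L" "set (p @ u) \<subseteq> set xs" "set ps \<subseteq> set xs \<times> set xs"
  shows "fmonom (p @ u) * com_prod ps - fmonom (p @ v) * com_prod ps \<in> S"
  using assms
proof (induction u arbitrary: v p)
  case Nil then show ?case using fpoly.subspace_0[OF S] by simp
next
  case (Cons x u)
  have "x \<in> set v" using Cons.prems(1) by (metis list.set_intros(1) mset_eq_setD)
  then obtain a b where v: "v = a @ x # b" by (meson split_list)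
  then have m: "mset u = mset (a @ b)" using Cons.prems(1) by simp
  have "fmonom ((p @ [x]) @ u) * com_prod ps - fmonom ((p @ [x]) @ (a @ b)) * com_prod ps \<in> S"
    using Cons.prems m by (intro Cons.IH) auto
  moreover have "fmonom (p @ x # a @ b) * com_prod ps - fmonom (p @ a @ x # b) * com_prod ps \<in> S"
    using Cons.prems m mset_eq_length[OF m] mset_eq_setD[OF m] by (intro move_mod_S) auto
  ultimately show ?case using S_diff_trans v by simp
qed

end

text \<open>
  The product of commutators has to stay arbitrary in the induction, since each exchange lengthens it
  while it shortens the word.
\<close>

lemma words_reduce_to_sorted:
  assumes S: "fpoly.subspace S" "T \<subseteq> S" and xs: "distinct xs"
    and sorted: "\<And>\<alpha> ps. set ps \<subseteq> set xs \<times> set xs \<Longrightarrow> distinct ps \<Longrightarrow> length (sorted_word xs \<alpha>) \<le> n \<Longrightarrow>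
      fmonom (sorted_word xs \<alpha>) * com_prod ps \<in> S"
  shows "set u \<subseteq> set xs \<Longrightarrow> set ps \<subseteq> set xs \<times> set xs \<Longrightarrow> length u \<le> n \<Longrightarrow> fmonom u * com_prod ps \<in> S"
proof (induction "length u" arbitrary: u ps rule: less_induct)
  case less
  show ?case
  proof (cases "distinct ps")
    case False
    then show ?thesis using com_prod_not_distinct T_left S by blast
  next
    case True
    have m: "mset (sorted_word xs (count (mset u))) = mset u"
      using xs less.prems by (intro mset_sorted_word) auto
    have "fmonom ([] @ u) * com_prod ps - fmonom ([] @ sorted_word xs (count (mset u))) * com_prod ps \<in> S"
      using less m by (intro permute_mod_S[where L = "length u" and xs = xs] S) auto
    moreover have "fmonom (sorted_word xs (count (mset u))) * com_prod ps \<in> S"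
      using True less.prems mset_eq_length[OF m] by (intro sorted) auto
    ultimately show ?thesis using fpoly.subspace_add[OF S(1)] by fastforce
  qed
qed

text \<open>
  The letters in \<open>N\<close> are those that can be repeated at most \<open>k\<close> times. The exponents \<open>\<alpha>\<close> are restricted to
  functions that are undefined outside \<open>xs\<close> so that the set of indices is finite and can be counted.
\<close>

lemma words_normal_form:
  fixes N :: "'x set" and k :: nat
  assumes xs: "distinct xs"
    and nil: "\<And>x w. x \<in> N \<Longrightarrow> k < count (mset w) x \<Longrightarrow> fmonom w \<in> T"
  defines "M n \<equiv> (\<lambda>(\<alpha>, ps). fmonom (sorted_word xs \<alpha>) * com_prod ps) `
    ((\<Pi>\<^sub>E x\<in>set xs. {..if x \<in> N then k else n}) \<times> {ps. set ps \<subseteq> set xs \<times> set xs \<and> distinct ps})"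
  assumes u: "set u \<subseteq> set xs" "length u \<le> n"
  shows "fmonom u \<in> fpoly.span (M n \<union> T)"
proof -
  have "fmonom u * com_prod [] \<in> fpoly.span (M n \<union> T)"
  proof (rule words_reduce_to_sorted[OF _ _ xs])
    show "T \<subseteq> fpoly.span (M n \<union> T)" using fpoly.span_superset[of "M n \<union> T"] by blast
    fix \<alpha> ps assume ps: "set ps \<subseteq> set xs \<times> set xs" "distinct ps"
      and len: "length (sorted_word xs \<alpha>) \<le> n"
    show "fmonom (sorted_word xs \<alpha>) * com_prod ps \<in> fpoly.span (M n \<union> T)"
    proof (cases "\<exists>x\<in>set xs \<inter> N. k < \<alpha> x")
      case True
      then obtain x where "x \<in> N" "k < count (mset (sorted_word xs \<alpha>)) x"
        by (auto simp: count_sorted_word[OF xs])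
      then show ?thesis using nil T_right by (blast intro: fpoly.span_base)
    next
      case False
      have le: "\<alpha> x \<le> n" if "x \<in> set xs" for x
        using that len count_sorted_word[OF xs, of \<alpha> x] count_le_length[of "sorted_word xs \<alpha>" x]
        by (metis count_mset le_trans)
      have "sorted_word xs (restrict \<alpha> (set xs)) = sorted_word xs \<alpha>"
        unfolding sorted_word_def by (intro arg_cong[where f = concat] map_cong) simp_all
      moreover have "restrict \<alpha> (set xs) \<in> (\<Pi>\<^sub>E x\<in>set xs. {..if x \<in> N then k else n})"
        using False le by (auto simp: not_less)
      ultimately have "fmonom (sorted_word xs \<alpha>) * com_prod ps \<in> M n"
        using ps unfolding M_def by (intro image_eqI[of _ _ "(restrict \<alpha> (set xs), ps)"]) auto
      then show ?thesis by (blast intro: fpoly.span_base)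
    qed
  qed (use u in auto)
  then show ?thesis by (simp add: com_prod_def)
qed

end

section \<open>Quotients of free algebras\<close>

abbreviation free_polys :: "'x set \<Rightarrow> ('x, 'f::field) fpoly set" where
  "free_polys X \<equiv> carrier (free_alg X)"

lemma free_alg_simps:
  "mult (free_alg X) = (*)" "one (free_alg X) = 1" "zero (free_alg X) = 0" "add (free_alg X) = (+)"
  "of_scalar (free_alg X) = Poly_Mapping.single 0"
  by (simp_all add: free_alg_def)

lemma free_polys_iff: "f \<in> free_polys X \<longleftrightarrow> (\<forall>w\<in>Poly_Mapping.keys f. set (letters w) \<subseteq> X)"
  by (simp add: free_alg_def)

lemma fmonom_in_free_polys [simp]: "fmonom u \<in> free_polys X \<longleftrightarrow> set u \<subseteq> X"
  by (simp add: free_polys_iff fmonom_def)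

lemma gen_in_free_polys [simp]: "gen x \<in> free_polys X \<longleftrightarrow> x \<in> X"
  by (simp add: gen_def)

lemma free_polys_closed [intro]:
  assumes "f \<in> free_polys X" "g \<in> free_polys X"
  shows "f + g \<in> free_polys X" "f * g \<in> free_polys X" "f - g \<in> free_polys X"
proof -
  interpret ring "free_alg X :: ('b, ('a, 'b) fpoly) falgebra" by (rule ring_free_alg)
  show "f + g \<in> free_polys X" "f * g \<in> free_polys X"
    using a_closed[OF assms] m_closed[OF assms] by (simp_all add: free_alg_simps)
  show "f - g \<in> free_polys X"
    using assms keys_diff[of f g] unfolding free_polys_iff by blast
qed

lemma const_in_free_polys [simp]:
  "Poly_Mapping.single 0 c \<in> free_polys X" "1 \<in> free_polys X" "0 \<in> free_polys X"
  by (auto simp: free_polys_iff letters_zero)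

lemma free_polys_scale [intro]: "f \<in> free_polys X \<Longrightarrow> scale_fpoly c f \<in> free_polys X"
  by (auto simp: scale_fpoly_def)

lemma free_polys_subspace: "fpoly.subspace (free_polys X)"
  unfolding fpoly.subspace_def by auto

text \<open>
  Both the Grassmann algebra and the relatively free algebra are quotients of a free algebra. The class map
  \<open>cl\<close> translates their operations into those of the type of polynomials, where the simplifier can
  calculate. Only classes of polynomials in the letters \<open>X\<close> are meaningful, hence the side conditions.
\<close>

locale free_quotient =
  fixes X :: "'x set" and I :: "('x, 'f::field) fpoly set"
  assumes I: "ideal I (free_alg X)"
begin

definition cl :: "('x, 'f) fpoly \<Rightarrow> ('x, 'f) fpoly set" where
  "cl f = I +>\<^bsub>free_alg X\<^esub> f"

abbreviation "Q \<equiv> quot_alg (free_alg X) I"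

interpretation Q: f_algebra Q
  by (rule f_algebra_quot_alg[OF f_algebra_free_alg I])

interpretation Id: ideal I "free_alg X" by (rule I)

lemma cl_hom: "cl \<in> ring_hom (free_alg X) (free_alg X Quot I)"
  using Id.rcos_ring_hom by (simp add: cl_def[abs_def])

lemma I_closed:
  "f \<in> I \<Longrightarrow> f \<in> free_polys X" "0 \<in> I" "f \<in> I \<Longrightarrow> g \<in> I \<Longrightarrow> f + g \<in> I"
  "f \<in> I \<Longrightarrow> g \<in> free_polys X \<Longrightarrow> g * f \<in> I" "f \<in> I \<Longrightarrow> g \<in> free_polys X \<Longrightarrow> f * g \<in> I"
  using Id.a_Hcarr additive_subgroup.zero_closed[OF Id.additive_subgroup_axioms]
    additive_subgroup.a_closed[OF Id.additive_subgroup_axioms, of f g]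
    Id.I_l_closed[of f g] Id.I_r_closed[of f g] by (simp_all add: free_alg_simps)

lemma I_subspace: "fpoly.subspace I"
  unfolding fpoly.subspace_def scale_fpoly_def using I_closed by auto

lemma I_comm: "f \<in> I \<Longrightarrow> g \<in> free_polys X \<Longrightarrow> commutator f g \<in> I"
  by (intro fpoly.subspace_diff[OF I_subspace] I_closed(4,5))

lemma cl_closed: "f \<in> free_polys X \<Longrightarrow> cl f \<in> carrier Q"
  using ring_hom_closed[OF cl_hom] by simp

lemma carrier_Q: "carrier Q = cl ` free_polys X"
  by (auto simp: FactRing_simps cl_def)

lemma cl_simps:
  "f \<in> free_polys X \<Longrightarrow> g \<in> free_polys X \<Longrightarrow> cl (f + g) = cl f \<oplus>\<^bsub>Q\<^esub> cl g"
  "f \<in> free_polys X \<Longrightarrow> g \<in> free_polys X \<Longrightarrow> cl (f * g) = cl f \<otimes>\<^bsub>Q\<^esub> cl g"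
  "cl 1 = \<one>\<^bsub>Q\<^esub>" "cl (Poly_Mapping.single 0 c) = of_scalar Q c"
  using ring_hom_add[OF cl_hom, of f g] ring_hom_mult[OF cl_hom, of f g] ring_hom_one[OF cl_hom]
  by (simp_all add: free_alg_simps, simp add: cl_def free_alg_simps)

lemma cl_eq_zero_iff: "f \<in> free_polys X \<Longrightarrow> cl f = \<zero>\<^bsub>Q\<^esub> \<longleftrightarrow> f \<in> I"
  using Id.a_rcos_self[of f] Id.a_rcos_const[of f] by (auto simp: cl_def FactRing_def)

lemma cl_zero: "cl 0 = \<zero>\<^bsub>Q\<^esub>"
  using cl_eq_zero_iff[of 0] I_closed by simp

lemma cl_scale: "f \<in> free_polys X \<Longrightarrow> cl (scale_fpoly c f) = of_scalar Q c \<otimes>\<^bsub>Q\<^esub> cl f"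
  unfolding scale_fpoly_def by (subst cl_simps) (auto simp: cl_simps)

lemma cl_diff:
  assumes "f \<in> free_polys X" "g \<in> free_polys X"
  shows "cl (f - g) = cl f \<ominus>\<^bsub>Q\<^esub> cl g"
proof -
  have "cl f = cl (f - g) \<oplus>\<^bsub>Q\<^esub> cl g"
    using assms cl_simps(1)[of "f - g" g] by auto
  then show ?thesis
    using assms by (simp add: a_minus_def cl_closed free_polys_closed Q.a_assoc Q.r_neg del: quot_alg_simps)
qed

lemma cl_eq_iff:
  assumes "f \<in> free_polys X" "g \<in> free_polys X"
  shows "cl f = cl g \<longleftrightarrow> f - g \<in> I"
proof -
  have "f - g \<in> I \<longleftrightarrow> cl f \<ominus>\<^bsub>Q\<^esub> cl g = \<zero>\<^bsub>Q\<^esub>"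
    using assms cl_eq_zero_iff[of "f - g"] by (auto simp: cl_diff)
  also have "\<dots> \<longleftrightarrow> cl f = cl g"
    using assms by (intro Q.r_right_minus_eq cl_closed)
  finally show ?thesis by simp
qed

lemma list_prod_cl: "set w \<subseteq> X \<Longrightarrow> list_prod Q (map (\<lambda>x. cl (gen x)) w) = cl (fmonom w)"
proof (induction w)
  case Nil then show ?case by (simp add: list_prod_def cl_simps del: quot_alg_simps)
next
  case (Cons x w)
  then have "list_prod Q (map (\<lambda>x. cl (gen x)) (x # w)) = cl (gen x) \<otimes>\<^bsub>Q\<^esub> cl (fmonom w)"
    by (simp add: list_prod_def)
  then show ?case using Cons.prems by (simp add: fmonom_Cons cl_simps del: quot_alg_simps)
qed

lemma cl_image_subspace:
  assumes W: "fpoly.subspace W" "W \<subseteq> free_polys X"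
  shows "subalgebra (scalars Q) (cl ` W) Q"
proof (rule Q.subalgebraI)
  show "cl ` W \<subseteq> carrier Q" using W cl_closed by blast
  show "\<zero>\<^bsub>Q\<^esub> \<in> cl ` W" using fpoly.subspace_0[OF W(1)] cl_zero by force
next
  fix x y assume "x \<in> cl ` W" "y \<in> cl ` W"
  then obtain f g where fg: "f \<in> W" "x = cl f" "g \<in> W" "y = cl g" by blast
  then have "x \<oplus>\<^bsub>Q\<^esub> y = cl (f + g)"
    using W(2) by (subst cl_simps) auto
  then show "x \<oplus>\<^bsub>Q\<^esub> y \<in> cl ` W" using fpoly.subspace_add[OF W(1) fg(1,3)] by blast
next
  fix c x assume "x \<in> cl ` W"
  then obtain f where f: "f \<in> W" "x = cl f" by blast
  then have "of_scalar Q c \<otimes>\<^bsub>Q\<^esub> x = cl (scale_fpoly c f)"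
    using W(2) by (subst cl_scale) auto
  then show "of_scalar Q c \<otimes>\<^bsub>Q\<^esub> x \<in> cl ` W" using fpoly.subspace_scale[OF W(1) f(1)] by blast
qed

end

text \<open>
  The set \<open>S\<close> is typically the preimage of an ideal under a linear map, which reduces multilinear
  identities to words one argument at a time.
\<close>

lemma free_poly_induct:
  assumes f: "f \<in> free_polys X" and S: "fpoly.subspace S"
    and words: "\<And>w. set w \<subseteq> X \<Longrightarrow> fmonom w \<in> S"
  shows "f \<in> S"
  by (rule fpoly_in_span_words[OF words S]) (use f in \<open>auto simp: free_polys_iff\<close>)

lemma subspace_vimage:
  assumes "fpoly.subspace S" "h 0 = 0" "\<And>f g. h (f + g) = h f + h g" "\<And>c f. h (scale_fpoly c f) = scale_fpoly c (h f)"
  shows "fpoly.subspace {f. h f \<in> S}"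
  using assms unfolding fpoly.subspace_def by auto

lemma scale_mult:
  "scale_fpoly c f * g = scale_fpoly c (f * g)" "g * scale_fpoly c f = scale_fpoly c (g * f)"
  unfolding scale_fpoly_def using scalar_central by (metis mult.assoc)+

section \<open>Growth of a quotient with central commutators\<close>

lemma com_prod_in_free_polys:
  "set ps \<subseteq> X \<times> X \<Longrightarrow> (com_prod ps :: ('x, 'f::field) fpoly) \<in> free_polys X"
proof (induction ps)
  case Nil then show ?case by (simp add: com_prod_def)
next
  case (Cons p ps)
  then obtain x y where "p = (x, y)" "x \<in> X" "y \<in> X" by auto
  moreover from this have "commutator (gen x) (gen y) \<in> (free_polys X :: ('x, 'f) fpoly set)"
    by (intro free_polys_closed(2,3)) auto
  ultimately show ?case
    using Cons by (simp add: com_prod_def free_polys_closed(2))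
qed

lemma set_sorted_word: "set (sorted_word xs \<alpha>) \<subseteq> set xs"
  by (auto simp: sorted_word_def)

definition degree_le :: "'x set \<Rightarrow> nat \<Rightarrow> ('x, 'f::field) fpoly set" where
  "degree_le X n = {f \<in> free_polys X. \<forall>w\<in>Poly_Mapping.keys f. length (letters w) \<le> n}"

lemma degree_le_mult:
  assumes "f \<in> degree_le X i" "g \<in> degree_le X j"
  shows "f * g \<in> degree_le X (i + j)"
  using assms unfolding degree_le_def
  by (fastforce dest!: keys_fword_mult simp: plus_fword_def add_mono)

lemma degree_le_subspace:
  fixes X :: "'a set"
  shows "fpoly.subspace (degree_le X n :: ('a, 'b::field) fpoly set)"
proof -
  have "scale_fpoly c f \<in> degree_le X n" if "f \<in> degree_le X n" for c and f :: "('a, 'b) fpoly"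
    using degree_le_mult[of "Poly_Mapping.single 0 c" X 0 f n] that
    by (auto simp: scale_fpoly_def degree_le_def letters_zero)
  moreover have "f + g \<in> degree_le X n" if "f \<in> degree_le X n" "g \<in> degree_le X n" for f g :: "('a, 'b) fpoly"
    using that keys_add[of f g] by (auto simp: degree_le_def)
  moreover have "(0 :: ('a, 'b) fpoly) \<in> degree_le X n"
    by (simp add: degree_le_def)
  ultimately show ?thesis
    unfolding fpoly.subspace_def by blast
qed

lemma in_degree_le:
  assumes "f \<in> free_polys X"
  shows "\<exists>n. f \<in> degree_le X n"
proof -
  have "length (letters w) \<le> (\<Sum>w\<in>Poly_Mapping.keys f. length (letters w))" if "w \<in> Poly_Mapping.keys f" for w
    using that by (intro member_le_sum) auto
  then show ?thesis using assms unfolding degree_le_def by blast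
qed

text \<open>
  The filtration is by degree. A polynomial of degree at most \<open>n\<close> is, modulo \<open>T\<close>, a combination of the normal
  forms of \<open>words_normal_form\<close>, whose number is the product of \<open>k + 1\<close> choices for each letter in \<open>N\<close>,
  \<open>n + 1\<close> choices for each other letter, and the number of repetition-free lists of pairs of letters.
\<close>

lemma (in lie_nilpotent_ideal) polynomially_filtered_quotient:
  fixes N :: "'x set" and k :: nat and xs :: "'x list"
  assumes xs: "distinct xs"
    and nil: "\<And>x w. x \<in> N \<Longrightarrow> k < count (mset w) x \<Longrightarrow> fmonom w \<in> T"
    and one: "1 \<notin> T"
    and ideal: "ideal (free_polys (set xs) \<inter> T) (free_alg (set xs))"
  shows "polynomially_filtered (quot_alg (free_alg (set xs)) (free_polys (set xs) \<inter> T)) (card (set xs - N))"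
proof -
  let ?X = "set xs"
  interpret R: free_quotient ?X "free_polys ?X \<inter> T" by (rule free_quotient.intro[OF ideal])
  interpret Q: f_algebra R.Q by (rule f_algebra_quot_alg[OF f_algebra_free_alg ideal])
  have K: "subfield (scalars R.Q) R.Q"
    using R.cl_eq_zero_iff[of 1] one by (intro Q.subfield_scalars) (simp add: R.cl_simps del: quot_alg_simps)
  have sub: "degree_le ?X n \<subseteq> free_polys ?X" for n :: nat
    by (auto simp: degree_le_def)
  define P where "P = {ps. set ps \<subseteq> ?X \<times> ?X \<and> distinct ps}"
  have finP: "finite P"
  proof -
    have "P \<subseteq> {ps. set ps \<subseteq> ?X \<times> ?X \<and> length ps \<le> card (?X \<times> ?X)}"
      using card_mono[of "?X \<times> ?X"] by (auto simp: P_def simp flip: distinct_card simp del: card_cartesian_product)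
    then show ?thesis by (rule finite_subset) (intro finite_lists_length_le, simp)
  qed
  define C where "C = (k + 1) ^ card (?X \<inter> N) * card P"
  define F where "F = (\<lambda>n. R.cl ` degree_le ?X n)"
  have span: "\<exists>us. set us \<subseteq> carrier R.Q \<and> length us \<le> C * (n + 1) ^ card (?X - N) \<and>
      F n \<subseteq> Q.Span (scalars R.Q) us" for n
  proof -
    define J where "J = (\<Pi>\<^sub>E x\<in>?X. {..if x \<in> N then k else n}) \<times> P"
    define M where "M = (\<lambda>(\<alpha>, ps). fmonom (sorted_word xs \<alpha>) * com_prod ps :: ('x, 'f) fpoly) ` J"
    have finJ: "finite J" using finP by (auto simp: J_def intro!: finite_PiE)
    have "card J = (\<Prod>x\<in>?X. if x \<in> N then k + 1 else n + 1) * card P"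
      by (simp add: J_def card_cartesian_product card_PiE if_distrib cong: if_cong)
    also have "(\<Prod>x\<in>?X. if x \<in> N then k + 1 else n + 1) = (k + 1) ^ card (?X \<inter> N) * (n + 1) ^ card (?X - N)"
      by (subst prod.If_cases) (auto simp: Diff_eq)
    finally have cardJ: "card J = C * (n + 1) ^ card (?X - N)" by (simp add: C_def mult_ac)
    have M: "M \<subseteq> free_polys ?X"
    proof
      fix f assume "f \<in> M"
      then obtain \<alpha> ps where "f = fmonom (sorted_word xs \<alpha>) * com_prod ps" "ps \<in> P"
        by (auto simp: M_def J_def)
      then show "f \<in> free_polys ?X"
        using set_sorted_word[of xs \<alpha>] by (auto simp: P_def intro!: free_polys_closed(2) com_prod_in_free_polys)
    qed
    obtain us where us: "set us = R.cl ` M" "length us = card (R.cl ` M)"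
    proof -
      have "finite (R.cl ` M)" using finJ by (simp add: M_def)
      then obtain us where "set us = R.cl ` M" "distinct us" using finite_distinct_list by blast
      then show ?thesis using that distinct_card by metis
    qed
    have "length us \<le> card J"
      unfolding us(2) M_def image_image by (rule card_image_le[OF finJ])
    moreover have usc: "set us \<subseteq> carrier R.Q"
      unfolding us(1) R.carrier_Q using M by (rule image_mono)
    moreover have "F n \<subseteq> Q.Span (scalars R.Q) us"
    proof
      fix x assume "x \<in> F n"
      then obtain f where f: "f \<in> degree_le ?X n" "x = R.cl f" by (auto simp: F_def)
      have "f \<in> fpoly.span (M \<union> T)"
      proof (rule fpoly_in_span_words[OF _ fpoly.subspace_span])
        fix w assume "w \<in> Poly_Mapping.keys f"
        then have "set (letters w) \<subseteq> ?X" "length (letters w) \<le> n"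
          using f(1) by (auto simp: degree_le_def free_polys_iff)
        then show "fmonom (letters w) \<in> fpoly.span (M \<union> T)"
          unfolding M_def J_def P_def by (intro words_normal_form[OF xs nil])
      qed
      then obtain g t where gt: "f = g + t" "g \<in> fpoly.span M" "t \<in> T"
        using fpoly.span_eq_iff[THEN iffD2, OF T_subspace] by (auto simp: fpoly.span_Un)
      \<comment> \<open>Since \<open>f\<close> and \<open>g\<close> only involve the letters \<open>xs\<close>, so does \<open>t\<close>, which therefore lies in the ideal of the quotient.\<close>
      have gX: "g \<in> free_polys ?X"
        using gt(2) fpoly.span_minimal[OF M free_polys_subspace] by blast
      have "t = f - g" using gt(1) by simp
      moreover have fX: "f \<in> free_polys ?X" using f(1) sub by (rule rev_subsetD)
      ultimately have "f - g \<in> free_polys ?X \<inter> T"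
        using gX gt(3) free_polys_closed(3) by auto
      then have "x = R.cl g"
        unfolding f(2) by (simp only: R.cl_eq_iff[OF fX gX])
      moreover have "R.cl g \<in> Q.Span (scalars R.Q) us"
      proof -
        have "g \<in> {g \<in> free_polys ?X. R.cl g \<in> Q.Span (scalars R.Q) us}"
        proof (rule subsetD[OF fpoly.span_minimal gt(2)])
          show "M \<subseteq> {g \<in> free_polys ?X. R.cl g \<in> Q.Span (scalars R.Q) us}"
          proof
            fix h assume h: "h \<in> M"
            then have "R.cl h \<in> Q.Span (scalars R.Q) us"
              using Q.Span_base_incl[OF K usc] us(1) by (auto simp del: Q.Span.simps)
            then show "h \<in> {g \<in> free_polys ?X. R.cl g \<in> Q.Span (scalars R.Q) us}"
              using h M by (auto simp del: Q.Span.simps)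
          qed
          note sp = Q.Span_subgroup_props[OF K usc] Q.Span_smult_closed[OF K usc]
          show "fpoly.subspace {g \<in> free_polys ?X. R.cl g \<in> Q.Span (scalars R.Q) us}"
            unfolding fpoly.subspace_def mem_Collect_eq
          proof (intro conjI ballI allI)
            show "R.cl 0 \<in> Q.Span (scalars R.Q) us"
              unfolding R.cl_zero by (rule sp(2))
          next
            fix f h assume "f \<in> {g \<in> free_polys ?X. R.cl g \<in> Q.Span (scalars R.Q) us}"
              "h \<in> {g \<in> free_polys ?X. R.cl g \<in> Q.Span (scalars R.Q) us}"
            then show "f + h \<in> free_polys ?X" "R.cl (f + h) \<in> Q.Span (scalars R.Q) us"
              using sp(3)[of "R.cl f" "R.cl h"] unfolding mem_Collect_eq
              by (auto simp only: R.cl_simps free_polys_closed)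
          next
            fix c f assume "f \<in> {g \<in> free_polys ?X. R.cl g \<in> Q.Span (scalars R.Q) us}"
            then show "scale_fpoly c f \<in> free_polys ?X" "R.cl (scale_fpoly c f) \<in> Q.Span (scalars R.Q) us"
              using sp(5)[of "of_scalar R.Q c" "R.cl f"] unfolding mem_Collect_eq scalars_def
              by (auto simp only: R.cl_scale free_polys_scale)
          qed simp
        qed
        then show ?thesis by simp
      qed
      ultimately show "x \<in> Q.Span (scalars R.Q) us" by simp
    qed
    ultimately show ?thesis using cardJ by auto
  qed
  show ?thesis
    unfolding polynomially_filtered_def
  proof (intro exI[of _ F] exI[of _ C] conjI allI ballI impI)
    show "subalgebra (scalars R.Q) (F n) R.Q" for n
      unfolding F_def by (rule R.cl_image_subspace[OF degree_le_subspace sub])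
    show "\<one>\<^bsub>R.Q\<^esub> \<in> F 0"
      unfolding F_def R.cl_simps(3)[symmetric]
      by (rule imageI) (simp add: degree_le_def letters_zero)
    show "F i \<subseteq> F j" if "i \<le> j" for i j
      unfolding F_def using that by (intro image_mono) (fastforce simp: degree_le_def)
    show "x \<otimes>\<^bsub>R.Q\<^esub> y \<in> F (i + j)" if "x \<in> F i" "y \<in> F j" for i j x y
    proof -
      obtain f g where fg: "f \<in> degree_le ?X i" "x = R.cl f" "g \<in> degree_le ?X j" "y = R.cl g"
        using \<open>x \<in> F i\<close> \<open>y \<in> F j\<close> by (auto simp: F_def)
      then have "x \<otimes>\<^bsub>R.Q\<^esub> y = R.cl (f * g)"
        using sub by (subst R.cl_simps(2)) auto
      then show ?thesis unfolding F_def using degree_le_mult[OF fg(1,3)] by blast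
    qed
    show "carrier R.Q \<subseteq> (\<Union>n. F n)"
      unfolding R.carrier_Q
    proof (rule image_subsetI)
      fix f :: "('x, 'f) fpoly" assume "f \<in> free_polys ?X"
      then obtain n where "f \<in> degree_le ?X n" using in_degree_le by blast
      then show "R.cl f \<in> (\<Union>n. F n)" unfolding F_def by auto
    qed
    show "\<exists>us. set us \<subseteq> carrier R.Q \<and> length us \<le> C * (n + 1) ^ card (?X - N) \<and>
      F n \<subseteq> Q.Span (scalars R.Q) us" for n
      by (rule span)
  qed
qed

section \<open>Anticommuting words in the Grassmann algebra\<close>

interpretation G: free_quotient "{1..}" "grassmann_ideal :: (nat, 'f::field) fpoly set"
  by (rule free_quotient.intro[OF ideal_grassmann_ideal])

lemma grassmann_anticommute:
  assumes "1 \<le> i" "1 \<le> j"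
  shows "gen i * gen j + gen j * gen i \<in> (grassmann_ideal :: (nat, 'f::field) fpoly set)"
proof -
  let ?R = "{fmonom [i, j] + fmonom [j, i] | i j. 1 \<le> i \<and> 1 \<le> j} :: (nat, 'f) fpoly set"
  have "?R \<subseteq> grassmann_ideal"
    unfolding grassmann_ideal_def
    by (rule ring.genideal_self[OF ring_free_alg]) (auto intro!: free_polys_closed)
  moreover have "gen i * gen j + gen j * gen i \<in> ?R"
    using assms by (auto simp: gen_def simp flip: fmonom_append)
  ultimately show ?thesis by blast
qed

lemma sign_closed: "(- 1) ^ n \<in> free_polys X"
proof -
  have "(- 1 :: ('a, 'b) fpoly) = 0 - 1" by simp
  then have "(- 1 :: ('a, 'b) fpoly) \<in> free_polys X" by (metis const_in_free_polys(2,3) free_polys_closed(3))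
  then show ?thesis by (cases "even n") simp_all
qed

lemma grassmann_gen_word:
  assumes "1 \<le> i" "set v \<subseteq> {1..}"
  shows "gen i * fmonom v - (- 1) ^ length v * (fmonom v * gen i) \<in> (grassmann_ideal :: (nat, 'f::field) fpoly set)"
  using assms(2)
proof (induction v)
  case Nil then show ?case using G.I_closed(2) by simp
next
  case (Cons j v)
  let ?s = "(- 1) ^ length v :: (nat, 'f) fpoly"
  have "gen i * fmonom (j # v) - (- 1) ^ length (j # v) * (fmonom (j # v) * gen i)
     = (gen i * gen j + gen j * gen i) * fmonom v
       - gen j * (gen i * fmonom v - ?s * (fmonom v * gen i))"
    by (cases "even (length v)") (simp_all add: fmonom_Cons algebra_simps)
  moreover have "(gen i * gen j + gen j * gen i) * fmonom v \<in> grassmann_ideal"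
    using Cons.prems assms(1) by (intro G.I_closed(5) grassmann_anticommute) auto
  moreover have "gen j * (gen i * fmonom v - ?s * (fmonom v * gen i)) \<in> grassmann_ideal"
    using Cons by (intro G.I_closed(4)) auto
  ultimately show ?case using fpoly.subspace_diff[OF G.I_subspace] by metis
qed

text \<open>
  Moving a word past another one exchanges each letter of one with each letter of the other, and each
  exchange contributes a sign.
\<close>

lemma grassmann_words_commute:
  assumes "set u \<subseteq> {1..}" "set v \<subseteq> {1..}"
  shows "fmonom u * fmonom v - (- 1) ^ (length u * length v) * (fmonom v * fmonom u)
    \<in> (grassmann_ideal :: (nat, 'f::field) fpoly set)"
  using assms(1)
proof (induction u)
  case Nil then show ?case using G.I_closed(2) by simp
next
  case (Cons i u)
  let ?s = "(- 1) ^ length v :: (nat, 'f) fpoly" and ?s' = "(- 1) ^ (length u * length v) :: (nat, 'f) fpoly"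
  have "fmonom (i # u) * fmonom v - (- 1) ^ (length (i # u) * length v) * (fmonom v * fmonom (i # u))
     = gen i * (fmonom u * fmonom v - ?s' * (fmonom v * fmonom u))
       + ?s' * (gen i * fmonom v - ?s * (fmonom v * gen i)) * fmonom u"
    by (cases "even (length v)"; cases "even (length u)")
       (simp_all add: fmonom_Cons algebra_simps)
  moreover have "gen i * (fmonom u * fmonom v - ?s' * (fmonom v * fmonom u)) \<in> grassmann_ideal"
    using Cons by (intro G.I_closed(4)) auto
  moreover have "?s' * (gen i * fmonom v - ?s * (fmonom v * gen i)) * fmonom u \<in> grassmann_ideal"
    using Cons.prems assms(2) by (intro G.I_closed(4,5) grassmann_gen_word sign_closed) auto
  ultimately show ?case using G.I_closed(3) by metis
qed

text \<open>
  If \<open>u\<close> or \<open>v\<close> has even length, they commute. Otherwise \<open>v u = - u v\<close>, so that their commutator is twice the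
  word \<open>u v\<close> of even length, which commutes with every word.
\<close>

lemma grassmann_comm_words:
  assumes "set u \<subseteq> {1..}" "set v \<subseteq> {1..}" "set w \<subseteq> {1..}"
  shows "commutator (commutator (fmonom u) (fmonom v)) (fmonom w) \<in> (grassmann_ideal :: (nat, 'f::field) fpoly set)"
proof (cases "even (length u * length v)")
  case True
  then have "commutator (fmonom u) (fmonom v) \<in> (grassmann_ideal :: (nat, 'f::field) fpoly set)"
    using grassmann_words_commute[OF assms(1,2)] by simp
  then show ?thesis
    by (rule G.I_comm) (use assms(3) in simp)
next
  case False
  let ?a = "fmonom u * fmonom v + fmonom v * fmonom u :: (nat, 'f) fpoly"
  have a: "?a \<in> grassmann_ideal" 
    using grassmann_words_commute[OF assms(1,2), where 'f = 'f] False by simp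
  have c: "commutator (fmonom (u @ v)) (fmonom w) \<in> (grassmann_ideal :: (nat, 'f::field) fpoly set)"
    using grassmann_words_commute[of "u @ v" w, where 'f = 'f] False assms by simp
  have "commutator (commutator (fmonom u) (fmonom v)) (fmonom w) =
     commutator (fmonom (u @ v)) (fmonom w) + commutator (fmonom (u @ v)) (fmonom w) - commutator ?a (fmonom w)"
    by (simp add: fmonom_append algebra_simps)
  moreover have "commutator ?a (fmonom w) \<in> grassmann_ideal"
    using a by (rule G.I_comm) (use assms(3) in simp)
  ultimately show ?thesis
    using fpoly.subspace_diff[OF G.I_subspace G.I_closed(3)[OF c c]] by simp
qed

lemma grassmann_comm:
  assumes "f \<in> free_polys {1..}" "g \<in> free_polys {1..}" "h \<in> free_polys {1..}"
  shows "commutator (commutator f g) h \<in> (grassmann_ideal :: (nat, 'f::field) fpoly set)"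
proof -
  note sp = subspace_vimage[OF G.I_subspace]
  have 1: "commutator (commutator (fmonom u) (fmonom v)) h \<in> grassmann_ideal" if "set u \<subseteq> {1..}" "set v \<subseteq> {1..}" for u v
  proof -
    have "h \<in> {h. commutator (commutator (fmonom u) (fmonom v)) h \<in> grassmann_ideal}"
    proof (rule free_poly_induct[OF assms(3) sp])
      fix w :: "nat list" assume "set w \<subseteq> {1..}"
      then show "fmonom w \<in> {h. commutator (commutator (fmonom u) (fmonom v)) h \<in> (grassmann_ideal :: (nat, 'f) fpoly set)}"
        using that grassmann_comm_words by blast
    qed (simp_all add: scale_mult fpoly.scale_right_diff_distrib algebra_simps)
    then show ?thesis by simp
  qed
  have 2: "commutator (commutator (fmonom u) g) h \<in> grassmann_ideal" if "set u \<subseteq> {1..}" for u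
  proof -
    have "g \<in> {g. commutator (commutator (fmonom u) g) h \<in> grassmann_ideal}"
    proof (rule free_poly_induct[OF assms(2) sp])
      fix w :: "nat list" assume "set w \<subseteq> {1..}"
      then show "fmonom w \<in> {g. commutator (commutator (fmonom u) g) h \<in> (grassmann_ideal :: (nat, 'f) fpoly set)}"
        using that 1 by blast
    qed (simp_all add: scale_mult fpoly.scale_right_diff_distrib algebra_simps)
    then show ?thesis by simp
  qed
  show ?thesis
  proof -
    have "f \<in> {f. commutator (commutator f g) h \<in> grassmann_ideal}"
    proof (rule free_poly_induct[OF assms(1) sp])
      fix w :: "nat list" assume "set w \<subseteq> {1..}"
      then show "fmonom w \<in> {f. commutator (commutator f g) h \<in> (grassmann_ideal :: (nat, 'f) fpoly set)}"
        using 2 by blast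
    qed (simp_all add: scale_mult fpoly.scale_right_diff_distrib algebra_simps)
    then show ?thesis by simp
  qed
qed

text \<open>
  The two occurrences can be brought together up to sign, and \<open>2 e\<^sub>i e\<^sub>i = 0\<close>.
\<close>

lemma grassmann_repeated_letter:
  assumes two: "(2::'f::field) \<noteq> 0" and u: "set u \<subseteq> {1..}" "\<not> distinct u"
  shows "fmonom u \<in> (grassmann_ideal :: (nat, 'f) fpoly set)"
proof -
  obtain a b c i where ui: "u = a @ [i] @ b @ [i] @ c"
    using u(2) not_distinct_decomp by blast
  let ?s = "(- 1) ^ length b :: (nat, 'f) fpoly"
  have sq: "gen i * gen i \<in> (grassmann_ideal :: (nat, 'f) fpoly set)"
    by (rule subspace_halve[OF G.I_subspace two], rule grassmann_anticommute) (use u ui in auto)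
  have eq: "fmonom u = fmonom a * ((gen i * fmonom b - ?s * (fmonom b * gen i)) * gen i
      + ?s * fmonom b * (gen i * gen i)) * fmonom c"
    by (cases "even (length b)") (simp_all add: ui fmonom_append fmonom_Cons algebra_simps)
  have "(gen i * fmonom b - ?s * (fmonom b * gen i)) * gen i \<in> grassmann_ideal"
    using u ui by (intro G.I_closed(5) grassmann_gen_word) auto
  moreover have "?s * fmonom b * (gen i * gen i) \<in> (grassmann_ideal :: (nat, 'f) fpoly set)"
    using u ui by (intro G.I_closed(4) sq free_polys_closed(2) sign_closed) auto
  ultimately have "(gen i * fmonom b - ?s * (fmonom b * gen i)) * gen i
      + ?s * fmonom b * (gen i * gen i) \<in> grassmann_ideal"
    by (rule G.I_closed(3))
  then have "fmonom a * ((gen i * fmonom b - ?s * (fmonom b * gen i)) * gen i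
      + ?s * fmonom b * (gen i * gen i)) * fmonom c \<in> grassmann_ideal"
    using u ui by (intro G.I_closed(4,5)) auto
  then show ?thesis by (simp only: eq)
qed

text \<open>
  The generators of odd degree are those with index at most \<open>k\<close>; this is the \<open>j\<close>-th power of the ideal that
  they generate in the free algebra.
\<close>

definition small_letters_ge :: "nat \<Rightarrow> nat \<Rightarrow> (nat, 'f::field) fpoly set" where
  "small_letters_ge k j = {f \<in> free_polys {1..}.
     \<forall>w\<in>Poly_Mapping.keys f. j \<le> length (filter (\<lambda>i. i \<le> k) (letters w))}"

lemma small_letters_ge_subset: "small_letters_ge k j \<subseteq> free_polys {1..}"
  by (auto simp: small_letters_ge_def)

lemma small_letters_ge_mult:
  assumes "f \<in> small_letters_ge k i" "g \<in> small_letters_ge k j"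
  shows "f * g \<in> small_letters_ge k (i + j)"
  using assms unfolding small_letters_ge_def
  by (fastforce dest!: keys_fword_mult simp: plus_fword_def add_mono)

lemma small_letters_ge_subspace: "fpoly.subspace (small_letters_ge k j)"
proof -
  have "scale_fpoly c f \<in> small_letters_ge k j" if "f \<in> small_letters_ge k j" for c f
    using small_letters_ge_mult[of "Poly_Mapping.single 0 c" k 0 f j] that
    by (auto simp: scale_fpoly_def small_letters_ge_def)
  then show ?thesis
    unfolding fpoly.subspace_def
    using keys_add by (fastforce simp: small_letters_ge_def)
qed

text \<open>
  More than \<open>k\<close> letters from \<open>{1..k}\<close> must contain a repetition.
\<close>

lemma small_letters_ge_vanishes:
  assumes two: "(2::'f::field) \<noteq> 0" and f: "f \<in> small_letters_ge k (Suc k)"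
  shows "f \<in> (grassmann_ideal :: (nat, 'f) fpoly set)"
proof (rule fpoly_in_span_words[OF _ G.I_subspace])
  fix w assume w: "w \<in> Poly_Mapping.keys f"
  let ?l = "filter (\<lambda>i. i \<le> k) (letters w)"
  have s: "set (letters w) \<subseteq> {1..}" and l: "k < length ?l"
    using f w unfolding small_letters_ge_def free_polys_iff by auto
  have "\<not> distinct (letters w)"
  proof
    assume "distinct (letters w)"
    then have "length ?l = card (set ?l)" by (simp only: distinct_card distinct_filter)
    also have "\<dots> \<le> card {1..k}" using s by (intro card_mono) auto
    finally show False using l by simp
  qed
  then show "fmonom (letters w) \<in> (grassmann_ideal :: (nat, 'f) fpoly set)"
    using grassmann_repeated_letter[OF two s] by simp
qed

lemma star_degree_eq: "star_degree k is = length (filter (\<lambda>i. i \<le> k) is)"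
  by (induction "is") (auto simp: star_degree_def)

lemma grassmann_one_neq_zero: "\<one>\<^bsub>grassmann\<^esub> \<noteq> (\<zero>\<^bsub>grassmann\<^esub> :: (nat, 'f::field) fpoly set)"
  unfolding grassmann_def
  by (rule one_neq_zero_quot_alg[OF ideal_grassmann_ideal])
     (use one_notin_grassmann_ideal in \<open>simp add: free_alg_def\<close>)

text \<open>
  A basis monomial of odd degree contains at least one generator of odd degree, since an odd number is
  not \<open>0\<close>.
\<close>

lemma star_component_small_letters_ge:
  assumes "j \<le> 1"
  shows "star_component k j \<subseteq> G.cl ` (small_letters_ge k j :: (nat, 'f::field) fpoly set)"
  unfolding star_component_def
proof (rule f_algebra.lin_span_least[OF f_algebra_grassmann grassmann_one_neq_zero])
  show "subalgebra (scalars grassmann) (G.cl ` small_letters_ge k j :: (nat, 'f) fpoly set set) grassmann"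
    unfolding grassmann_def
    by (rule G.cl_image_subspace[OF small_letters_ge_subspace small_letters_ge_subset])
  show "{grassmann_monom is |is. set is \<subseteq> {1..} \<and> sorted_wrt (<) is \<and> star_degree k is mod 2 = j}
      \<subseteq> G.cl ` (small_letters_ge k j :: (nat, 'f) fpoly set)"
  proof clarify
    fix js assume "set js \<subseteq> {1..}" and j: "j = star_degree k js mod 2"
    have "fmonom js \<in> (small_letters_ge k (star_degree k js mod 2) :: (nat, 'f) fpoly set)"
      using \<open>set js \<subseteq> {1..}\<close> by (auto simp: small_letters_ge_def) (auto simp: fmonom_def star_degree_eq)
    then show "grassmann_monom js \<in> G.cl ` (small_letters_ge k (star_degree k js mod 2) :: (nat, 'f) fpoly set)"
      unfolding grassmann_monom_def G.cl_def[symmetric] by (rule imageI)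
  qed
qed

section \<open>Graded identities of the star gradings\<close>

text \<open>
  The generators of the Grassmann algebra are indexed by the set \<open>{1..}\<close>, on which the class map
  depends. Rewriting \<open>1\<close> to \<open>Suc 0\<close> would separate terms over \<open>{1..}\<close> from the lemmas about them.
\<close>

declare One_nat_def [simp del]

definition admissible :: "nat \<Rightarrow> (gvar \<Rightarrow> (nat, 'f::field) fpoly set) \<Rightarrow> bool" where
  "admissible k \<phi> \<longleftrightarrow> (\<forall>i. \<phi> (Y i) \<in> star_component k 0 \<and> \<phi> (Z i) \<in> star_component k 1)"

abbreviation star_eval :: "nat \<Rightarrow> (gvar \<Rightarrow> (nat, 'f::field) fpoly set) \<Rightarrow> (gvar, 'f) fpoly \<Rightarrow> (nat, 'f) fpoly set" where
  "star_eval k \<equiv> eval_fpoly (grassmann_star k :: ('f, (nat, 'f) fpoly set) z2_algebra)"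

interpretation star: f_algebra "grassmann_star k :: ('f::field, (nat, 'f) fpoly set) z2_algebra" for k
  by (rule f_algebra_grassmann_star)

lemma T_Z2_star_iff: "f \<in> T_Z2 (grassmann_star k) \<longleftrightarrow> (\<forall>\<phi>. admissible k \<phi> \<longrightarrow> star_eval k \<phi> f = \<zero>\<^bsub>grassmann\<^esub>)"
  by (simp add: T_Z2_def admissible_def)

lemma admissible_closed: "admissible k \<phi> \<Longrightarrow> \<phi> x \<in> carrier (grassmann_star k)"
  using star_component_subset unfolding admissible_def grassmann_star_simps by (cases x) blast+

lemma star_eval_simps:
  assumes "admissible k \<phi>"
  shows "star_eval k \<phi> (f + g) = star_eval k \<phi> f \<oplus>\<^bsub>grassmann\<^esub> star_eval k \<phi> g"
    "star_eval k \<phi> (f * g) = star_eval k \<phi> f \<otimes>\<^bsub>grassmann\<^esub> star_eval k \<phi> g"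
    "star_eval k \<phi> f \<in> carrier grassmann"
    "star_eval k \<phi> (fmonom w) = list_prod (grassmann_star k) (map \<phi> w)"
  using star.eval_add[where \<phi> = \<phi> and k = k and f = f and g = g]
    star.eval_mult[where \<phi> = \<phi> and k = k and f = f and g = g]
    star.eval_closed[where \<phi> = \<phi> and k = k and f = f]
    star.eval_single[where \<phi> = \<phi> and k = k and u = "FWord w" and a = 1]
    star.word_closed[where \<phi> = \<phi> and k = k and xs = w]
    admissible_closed[OF assms]
  by (simp_all add: fmonom_def f_algebra.sc_one[OF f_algebra_grassmann]
      monoid.l_one[OF ring.is_monoid[OF ring_grassmann]])

lemma carrier_grassmann: "carrier grassmann = G.cl ` free_polys {1..}"
  unfolding grassmann_def by (rule G.carrier_Q)

lemma cl_grassmann: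
  "f \<in> free_polys {1..} \<Longrightarrow> g \<in> free_polys {1..} \<Longrightarrow> G.cl (f + g) = G.cl f \<oplus>\<^bsub>grassmann\<^esub> G.cl g"
  "f \<in> free_polys {1..} \<Longrightarrow> g \<in> free_polys {1..} \<Longrightarrow> G.cl (f * g) = G.cl f \<otimes>\<^bsub>grassmann\<^esub> G.cl g"
  "G.cl 1 = \<one>\<^bsub>grassmann\<^esub>" "G.cl (Poly_Mapping.single 0 c) = of_scalar grassmann c"
  "f \<in> free_polys {1..} \<Longrightarrow> G.cl f = \<zero>\<^bsub>grassmann\<^esub> \<longleftrightarrow> f \<in> grassmann_ideal"
  unfolding grassmann_def by (rule G.cl_simps G.cl_eq_zero_iff; assumption)+

text \<open>
  Evaluations are lifted to representing polynomials in the generators, where \<open>grassmann_comm\<close> applies.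
\<close>

lemma star_eval_rep:
  assumes "admissible k \<phi>"
  shows "\<exists>f'\<in>free_polys {1..}. star_eval k \<phi> f = G.cl f'"
  using star_eval_simps(3)[OF assms, of f] unfolding carrier_grassmann by blast

lemma star_eval_mult:
  assumes "admissible k \<phi>" "star_eval k \<phi> f = G.cl f'" "star_eval k \<phi> g = G.cl g'"
    "f' \<in> free_polys {1..}" "g' \<in> free_polys {1..}"
  shows "star_eval k \<phi> (f * g) = G.cl (f' * g')"
  using assms by (simp add: star_eval_simps(2)[OF assms(1)] cl_grassmann)

lemma star_eval_diff:
  assumes "admissible k \<phi>" "star_eval k \<phi> f = G.cl f'" "star_eval k \<phi> g = G.cl g'"
    "f' \<in> free_polys {1..}" "g' \<in> free_polys {1..}"
  shows "star_eval k \<phi> (f - g) = G.cl (f' - g')"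
proof -
  obtain h where h: "h \<in> free_polys {1..}" "star_eval k \<phi> (f - g) = G.cl h"
    using star_eval_rep[OF assms(1)] by blast
  have "G.cl f' = G.cl (h + g')"
    using star_eval_simps(1)[OF assms(1), of "f - g" g] assms h by (simp add: cl_grassmann)
  then have "f' - (h + g') \<in> grassmann_ideal"
    using assms(4,5) h(1) by (subst (asm) G.cl_eq_iff) (auto intro: free_polys_closed)
  then have "(f' - g') - h \<in> grassmann_ideal" by (simp add: algebra_simps)
  then have "G.cl (f' - g') = G.cl h"
    using assms(4,5) h(1) by (subst G.cl_eq_iff) (auto intro: free_polys_closed)
  then show ?thesis using h(2) by simp
qed

lemma star_lie_nilpotent:
  assumes "admissible k \<phi>"
  shows "star_eval k \<phi> (commutator (commutator f g) h) = \<zero>\<^bsub>grassmann\<^esub>"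
proof -
  obtain f' g' h' where r: "f' \<in> free_polys {1..}" "star_eval k \<phi> f = G.cl f'"
    "g' \<in> free_polys {1..}" "star_eval k \<phi> g = G.cl g'"
    "h' \<in> free_polys {1..}" "star_eval k \<phi> h = G.cl h'"
    using star_eval_rep[OF assms] by metis
  have "star_eval k \<phi> (commutator (commutator f g) h) = G.cl (commutator (commutator f' g') h')"
    using r by (intro star_eval_diff star_eval_mult assms free_polys_closed(2,3))
  also have "\<dots> = \<zero>\<^bsub>grassmann\<^esub>"
    using r grassmann_comm[of f' g' h'] G.I_closed(1) by (subst cl_grassmann(5)) blast+
  finally show ?thesis .
qed

text \<open>
  Each odd variable contributes at least one odd generator to the value of a word.
\<close>

lemma list_prod_small_letters_ge:
  assumes "admissible k \<phi>"
  shows "list_prod (grassmann_star k) (map \<phi> w)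
    \<in> G.cl ` (small_letters_ge k (length (filter (\<lambda>x. x \<in> range Z) w)) :: (nat, 'f::field) fpoly set)"
proof (induction w)
  case Nil
  have "(1 :: (nat, 'f) fpoly) \<in> small_letters_ge k 0" by (simp add: small_letters_ge_def)
  then show ?case using cl_grassmann(3) by (force simp: list_prod_def)
next
  case (Cons x w)
  have "\<phi> x \<in> G.cl ` small_letters_ge k (if x \<in> range Z then 1 else 0)"
    using assms star_component_small_letters_ge[of 0 k] star_component_small_letters_ge[of 1 k]
    unfolding admissible_def by (cases x) auto
  then obtain f g where fg: "f \<in> small_letters_ge k (if x \<in> range Z then 1 else 0)" "\<phi> x = G.cl f"
    "g \<in> small_letters_ge k (length (filter (\<lambda>x. x \<in> range Z) w))"
    "list_prod (grassmann_star k) (map \<phi> w) = G.cl g"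
    using Cons by blast
  have "f \<in> free_polys {1..}" "g \<in> free_polys {1..}"
    using fg small_letters_ge_subset by blast+
  then have "list_prod (grassmann_star k) (map \<phi> (x # w)) = G.cl (f * g)"
    using fg by (simp add: list_prod_def cl_grassmann)
  moreover have "f * g \<in> small_letters_ge k (length (filter (\<lambda>x. x \<in> range Z) (x # w)))"
    using small_letters_ge_mult[OF fg(1,3)] by (auto simp: One_nat_def split: if_splits)
  ultimately show ?case by blast
qed

lemma small_letters_ge_antimono: "i \<le> j \<Longrightarrow> small_letters_ge k j \<subseteq> small_letters_ge k i"
  by (fastforce simp: small_letters_ge_def)

lemma star_nilpotent_letter:
  assumes two: "(2::'f::field) \<noteq> 0" and x: "x \<in> range Z" "k < count (mset w) x"
  shows "fmonom w \<in> T_Z2 (grassmann_star k :: ('f, (nat, 'f) fpoly set) z2_algebra)"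
  unfolding T_Z2_star_iff
proof (intro allI impI)
  fix \<phi> :: "gvar \<Rightarrow> (nat, 'f) fpoly set" assume \<phi>: "admissible k \<phi>"
  have "count (mset w) x = count (mset (filter (\<lambda>x. x \<in> range Z) w)) x"
    using x(1) by simp
  also have "\<dots> \<le> length (filter (\<lambda>x. x \<in> range Z) w)"
    using count_le_size[of "mset (filter (\<lambda>x. x \<in> range Z) w)" x] by (simp only: size_mset)
  finally have len: "Suc k \<le> length (filter (\<lambda>x. x \<in> range Z) w)"
    using x(2) by linarith
  have "star_eval k \<phi> (fmonom w) = list_prod (grassmann_star k) (map \<phi> w)"
    by (rule star_eval_simps(4)[OF \<phi>])
  moreover obtain f where f: "f \<in> small_letters_ge k (length (filter (\<lambda>x. x \<in> range Z) w))"
      "list_prod (grassmann_star k) (map \<phi> w) = G.cl f"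
    using list_prod_small_letters_ge[OF \<phi>, of w] by (elim imageE)
  moreover have "f \<in> small_letters_ge k (Suc k)"
    using small_letters_ge_antimono[OF len] f(1) by (rule subsetD)
  then have "f \<in> grassmann_ideal"
    by (rule small_letters_ge_vanishes[OF two])
  then have "G.cl f = \<zero>\<^bsub>grassmann\<^esub>"
    using G.I_closed(1) cl_grassmann(5) by blast
  ultimately show "star_eval k \<phi> (fmonom w) = \<zero>\<^bsub>grassmann\<^esub>"
    by simp
qed

lemma lie_nilpotent_ideal_T_Z2:
  assumes two: "(2::'f::field) \<noteq> 0"
  shows "lie_nilpotent_ideal (T_Z2 (grassmann_star k :: ('f, (nat, 'f) fpoly set) z2_algebra))"
proof (rule lie_nilpotent_ideal.intro[OF _ _ _ _ _ two])
  let ?B = "grassmann_star k :: ('f, (nat, 'f) fpoly set) z2_algebra"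
  interpret C: f_algebra "grassmann :: ('f, (nat, 'f) fpoly set) falgebra" by (rule f_algebra_grassmann)
  have closed: "star_eval k \<phi> f \<in> carrier grassmann" if "admissible k \<phi>" for \<phi> and f :: "(gvar, 'f) fpoly"
    using star_eval_simps(3)[OF that] by simp
  show "0 \<in> T_Z2 ?B"
    by (simp add: T_Z2_star_iff eval_fpoly_def)
  show "f + g \<in> T_Z2 ?B" if "f \<in> T_Z2 ?B" "g \<in> T_Z2 ?B" for f g
    using that by (simp add: T_Z2_star_iff star_eval_simps(1))
  show "g * f \<in> T_Z2 ?B" "f * g \<in> T_Z2 ?B" if "f \<in> T_Z2 ?B" for f g
    using that by (simp_all add: T_Z2_star_iff star_eval_simps(2) closed)
  show "commutator (commutator f g) h \<in> T_Z2 ?B" for f g h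
    by (simp add: T_Z2_star_iff star_lie_nilpotent)
qed

section \<open>Independent monomials in the even variables\<close>

text \<open>
  The monomial \<open>y\<^sub>1\<^bsup>a1\<^esup> \<cdots> y\<^sub>m\<^bsup>am\<^esup>\<close> whose exponents are the digits of \<open>e = a1 + a2 q + \<dots> + am q\<^bsup>m-1\<^esup>\<close> in base \<open>q\<close>.
  Indexing by \<open>e\<close> lists the monomials with exponents below \<open>q\<close> without repetition.
\<close>

fun kronecker_word :: "nat \<Rightarrow> nat \<Rightarrow> nat \<Rightarrow> gvar list" where
  "kronecker_word q 0 e = []"
| "kronecker_word q (Suc j) e = kronecker_word q j (e mod q ^ j) @ replicate (e div q ^ j) (Y (Suc j))"

text \<open>
  The odd variables can only take the scalar value \<open>0\<close>.
\<close>

definition kronecker_point :: "nat \<Rightarrow> 'f::field \<Rightarrow> gvar \<Rightarrow> 'f" where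
  "kronecker_point q t x = (case x of Y j \<Rightarrow> t ^ q ^ (j - 1) | Z j \<Rightarrow> 0)"

lemma set_kronecker_word: "set (kronecker_word q m e) \<subseteq> Y ` {1..m}"
proof (induction m arbitrary: e)
  case (Suc m)
  have "set (kronecker_word q m (e mod q ^ m)) \<subseteq> Y ` {1..Suc m}"
    using Suc[of "e mod q ^ m"] by (rule order_trans) auto
  then show ?case by auto
qed simp

lemma length_kronecker_word: "e < q ^ m \<Longrightarrow> length (kronecker_word q m e) \<le> m * q"
proof (induction m arbitrary: e)
  case (Suc m)
  then have "e div q ^ m < q" by (simp add: less_mult_imp_div_less)
  moreover have "0 < q ^ m" using Suc.prems by (cases q) auto
  ultimately show ?case using Suc.IH[of "e mod q ^ m"] by simp
qed simp

lemma prod_kronecker_word: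
  "e < q ^ m \<Longrightarrow> prod_list (map (kronecker_point q t) (kronecker_word q m e)) = t ^ e"
proof (induction m arbitrary: e)
  case (Suc m)
  have "kronecker_point q t (Y (Suc m)) = t ^ q ^ m"
    by (simp add: kronecker_point_def One_nat_def)
  moreover have "0 < q ^ m" using Suc.prems by (cases q) auto
  ultimately have "prod_list (map (kronecker_point q t) (kronecker_word q (Suc m) e))
      = t ^ (e mod q ^ m) * (t ^ (q ^ m)) ^ (e div q ^ m)"
    using Suc.IH[of "e mod q ^ m"] by simp
  also have "\<dots> = t ^ e"
    by (simp flip: power_mult power_add)
  finally show ?case .
qed simp

lemma scalar_in_star_component:
  fixes c :: "'f::field"
  shows "of_scalar grassmann c \<in> star_component k 0"
proof -
  let ?G = "grassmann :: ('f, (nat, 'f) fpoly set) falgebra"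
  interpret C: f_algebra ?G by (rule f_algebra_grassmann)
  let ?S = "{\<one>\<^bsub>?G\<^esub>}"
  have "grassmann_monom [] = \<one>\<^bsub>?G\<^esub>"
    unfolding grassmann_monom_def G.cl_def[symmetric] by (simp add: cl_grassmann(3))
  then have S: "?S \<subseteq> {grassmann_monom is | is. set is \<subseteq> {1..} \<and> sorted_wrt (<) is \<and> star_degree k is mod 2 = 0}"
    by (auto simp: star_degree_def intro!: exI[of _ "[]"])
  have "subalgebra (scalars ?G) (lin_span ?G ?S) ?G"
    by (rule C.subalgebra_lin_span[OF grassmann_one_neq_zero]) simp
  moreover have "\<one>\<^bsub>?G\<^esub> \<in> lin_span ?G ?S"
    using C.lin_span_superset[OF grassmann_one_neq_zero, of ?S] by simp
  ultimately have "of_scalar ?G c \<otimes>\<^bsub>?G\<^esub> \<one>\<^bsub>?G\<^esub> \<in> lin_span ?G ?S"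
    by (intro subalgebra.smult_closed) (auto simp: scalars_def)
  moreover have "lin_span ?G ?S \<subseteq> star_component k 0"
    unfolding star_component_def lin_span_def using S by (intro UN_mono lists_mono) auto
  ultimately show ?thesis by auto
qed

lemma zero_in_star_component: "\<zero>\<^bsub>grassmann\<^esub> \<in> star_component k d"
  by (auto simp: star_component_def lin_span_def
    ring.Span.simps[OF ring_grassmann] intro!: bexI[of _ "[]"])

text \<open>
  Equality of scalars in the Grassmann algebra has to be carried back to the field, where values of
  polynomials are compared.
\<close>

lemma of_scalar_grassmann_inj:
  assumes "of_scalar grassmann a = (of_scalar grassmann b :: (nat, 'f::field) fpoly set)"
  shows "a = b"
proof (rule ccontr)
  assume "a \<noteq> b"
  interpret C: f_algebra "grassmann :: ('f, (nat, 'f) fpoly set) falgebra" by (rule f_algebra_grassmann)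
  have z: "of_scalar grassmann (a - b) = (\<zero>\<^bsub>grassmann\<^esub> :: (nat, 'f::field) fpoly set)"
    using C.sc_add[of "a - b" b] assms C.add.l_cancel_one'[of "of_scalar grassmann b"] 
    by (metis C.a_comm C.add.l_cancel_one' C.sc_closed diff_add_cancel)
  have "\<one>\<^bsub>grassmann\<^esub> = of_scalar grassmann ((a - b) * inverse (a - b))"
    using \<open>a \<noteq> b\<close> by (simp add: C.sc_one)
  also have "\<dots> = (\<zero>\<^bsub>grassmann\<^esub> :: (nat, 'f::field) fpoly set)" by (simp add: C.sc_mult z)
  finally show False using grassmann_one_neq_zero by blast
qed

context
  fixes c :: "gvar \<Rightarrow> 'f::field"
  assumes c: "\<And>i. c (Z i) = 0"
begin

lemma admissible_scalar: "admissible k (\<lambda>x. of_scalar grassmann (c x))"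
proof -
  interpret C: f_algebra "grassmann :: ('f, (nat, 'f) fpoly set) falgebra" by (rule f_algebra_grassmann)
  show ?thesis
    unfolding admissible_def using c by (simp add: C.sc_zero scalar_in_star_component zero_in_star_component)
qed

lemma star_eval_scalar_word:
  "star_eval k (\<lambda>x. of_scalar grassmann (c x)) (fmonom w) = of_scalar grassmann (prod_list (map c w))"
proof -
  have "list_prod (grassmann_star k) (map (\<lambda>x. of_scalar (grassmann_star k) (c x)) w)
      = of_scalar (grassmann_star k) (prod_list (map c w))" for k
    by (induction w) (simp_all add: list_prod_def star.sc_mult star.sc_one del: grassmann_star_simps)
  then show ?thesis
    unfolding star_eval_simps(4)[OF admissible_scalar] by simp
qed

end

lemma star_eval_const:
  assumes "admissible k \<phi>"
  shows "star_eval k \<phi> (Poly_Mapping.single 0 c) = of_scalar grassmann c"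
  using star.eval_single[where \<phi> = \<phi> and k = k and u = 0 and a = c] admissible_closed[OF assms]
  by (simp add: letters_zero list_prod_def monoid.r_one[OF ring.is_monoid[OF ring_grassmann]]
    f_algebra.sc_closed[OF f_algebra_grassmann])

text \<open>
  At the Kronecker point of parameter \<open>t\<close> the word with index \<open>e\<close> takes the value \<open>t\<^sup>e\<close>. Were the word with
  index \<open>n\<close> a combination of those with smaller indices, \<open>t\<^sup>n\<close> would agree with a polynomial of degree less
  than \<open>n\<close> at all points of an infinite field. The list is reversed because independence is built up from the
  end of a list.
\<close>

lemma kronecker_words_independent:
  fixes k m q :: nat
  defines "B \<equiv> grassmann_star k :: ('f::field, (nat, 'f) fpoly set) z2_algebra"
    and "X \<equiv> Y ` {1..m} \<union> Z ` {1..m}"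
  assumes inf: "infinite (UNIV :: 'f set)" and n: "n \<le> q ^ m"
  shows "ring.independent (rel_free_Z2 m B) (scalars (rel_free_Z2 m B))
    (map (\<lambda>e. free_quotient.cl X (free_polys X \<inter> T_Z2 B) (fmonom (kronecker_word q m e))) (rev [0..<n]))"
proof -
  let ?R = "rel_free_Z2 m B"
  have ideal: "ideal (free_polys X \<inter> T_Z2 B) (free_alg X)"
    unfolding B_def by (intro ideal_T_Z2 f_algebra_grassmann_star) (simp_all add: star_component_subset)
  interpret Q: free_quotient X "free_polys X \<inter> T_Z2 B" by (rule free_quotient.intro[OF ideal])
  have R: "?R = Q.Q" by (simp add: rel_free_Z2_def free_alg_YZ_def X_def)
  interpret R: f_algebra ?R unfolding B_def by (rule f_algebra_rel_free)
  have K: "subfield (scalars ?R) ?R" unfolding B_def by (rule subfield_scalars_rel_free)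
  define pt where "pt = (\<lambda>t::'f. \<lambda>x. of_scalar grassmann (kronecker_point q t x))"
  have adm: "admissible k (pt t)" for t
    unfolding pt_def by (rule admissible_scalar) (simp add: kronecker_point_def)
  have word: "star_eval k (pt t) (fmonom (kronecker_word q m e)) = of_scalar grassmann (t ^ e)" if "e < q ^ m" for t e
    unfolding pt_def by (subst star_eval_scalar_word) (simp add: kronecker_point_def, simp only: prod_kronecker_word[OF that])
  have kX: "fmonom (kronecker_word q m e) \<in> (free_polys X :: (gvar, 'f) fpoly set)" for e
    using set_kronecker_word[of q m e] by (auto simp: X_def)
  \<comment> \<open>Polynomials whose values along the Kronecker curve are polynomial in \<open>t\<close> of degree less than \<open>n\<close>.\<close>
  define U where "U = (\<lambda>n. {f \<in> free_polys X. \<exists>P. (\<forall>i\<ge>n. coeff P i = 0) \<and>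
      (\<forall>t. star_eval k (pt t) f = of_scalar grassmann (poly P t))})"
  interpret C: f_algebra "grassmann :: ('f, (nat, 'f) fpoly set) falgebra" by (rule f_algebra_grassmann)
  have U: "fpoly.subspace (U n)" for n
    unfolding fpoly.subspace_def
  proof (intro conjI ballI allI)
    show "0 \<in> U n"
      by (auto simp: U_def eval_fpoly_def C.sc_zero intro!: exI[of _ 0])
  next
    fix f g assume "f \<in> U n" "g \<in> U n"
    then obtain P P' where P: "f \<in> free_polys X" "g \<in> free_polys X" "\<forall>i\<ge>n. coeff P i = 0" "\<forall>i\<ge>n. coeff P' i = 0"
      "\<And>t. star_eval k (pt t) f = of_scalar grassmann (poly P t)"
      "\<And>t. star_eval k (pt t) g = of_scalar grassmann (poly P' t)"
      by (auto simp: U_def)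
    then show "f + g \<in> U n"
      by (auto simp: U_def star_eval_simps(1)[OF adm] C.sc_add intro!: exI[of _ "P + P'"])
  next
    fix c f assume "f \<in> U n"
    then obtain P where P: "f \<in> free_polys X" "\<forall>i\<ge>n. coeff P i = 0"
      "\<And>t. star_eval k (pt t) f = of_scalar grassmann (poly P t)"
      by (auto simp: U_def)
    have "star_eval k (pt t) (scale_fpoly c f) = of_scalar grassmann (poly (smult c P) t)" for t
      using star_eval_const[OF adm, of t c] P(3) by (simp add: scale_fpoly_def star_eval_simps(2)[OF adm] C.sc_mult)
    then show "scale_fpoly c f \<in> U n"
      using P by (auto simp: U_def intro!: exI[of _ "smult c P"])
  qed
  have mem: "fmonom (kronecker_word q m e) \<in> U n" if "e < n" "n \<le> q ^ m" for e n
    using that kX by (auto simp: U_def word poly_monom intro!: exI[of _ "monom 1 e"])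
  have notmem: "Q.cl (fmonom (kronecker_word q m n)) \<notin> Q.cl ` U n" if "n < q ^ m" for n
  proof
    assume "Q.cl (fmonom (kronecker_word q m n)) \<in> Q.cl ` U n"
    then obtain f P where f: "Q.cl (fmonom (kronecker_word q m n)) = Q.cl f" "f \<in> free_polys X"
      and P: "\<forall>i\<ge>n. coeff P i = 0" "\<And>t. star_eval k (pt t) f = of_scalar grassmann (poly P t)"
      by (auto simp: U_def)
    then have T: "fmonom (kronecker_word q m n) - f \<in> T_Z2 B"
      using kX by (auto simp: Q.cl_eq_iff)
    have "t ^ n = poly P t" for t
    proof (rule of_scalar_grassmann_inj)
      have "star_eval k (pt t) (fmonom (kronecker_word q m n) - f + f) = star_eval k (pt t) f"
        using T adm[of t] C.l_zero[OF star_eval_simps(3)[OF adm]]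
        unfolding B_def T_Z2_star_iff star_eval_simps(1)[OF adm] by simp
      then show "of_scalar grassmann (t ^ n) = (of_scalar grassmann (poly P t) :: (nat, 'f) fpoly set)"
        using P(2)[of t] word[OF that, of t] by simp
    qed
    then have "{t. poly (monom 1 n - P) t = 0} = UNIV"
      by (auto simp: poly_monom)
    then have "monom 1 n - P = 0"
      using inf poly_roots_finite by metis
    then have "coeff (monom 1 n - P) n = 0" by simp
    then show False using P(1) by simp
  qed
  show ?thesis
    using n
  proof (induction n)
    case (Suc n)
    let ?us = "map (\<lambda>e. Q.cl (fmonom (kronecker_word q m e))) (rev [0..<n])"
    have "R.Span (scalars ?R) ?us \<subseteq> Q.cl ` U n"
    proof (rule R.subalgebra_Span_incl[OF K])
      show "subalgebra (scalars ?R) (Q.cl ` U n) ?R"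
        unfolding R by (rule Q.cl_image_subspace[OF U]) (auto simp: U_def)
      show "set ?us \<subseteq> Q.cl ` U n"
        using mem Suc.prems by auto
    qed
    then have "Q.cl (fmonom (kronecker_word q m n)) \<notin> R.Span (scalars ?R) ?us"
      using notmem[of n] Suc.prems by (meson Suc_le_lessD subsetD)
    moreover have "Q.cl (fmonom (kronecker_word q m n)) \<in> carrier ?R"
      unfolding R using kX by (rule Q.cl_closed)
    ultimately show ?case
      using Suc R.li_Cons by simp
  qed simp
qed

section \<open>The graded Gelfand--Kirillov dimension\<close>

theorem theorem4p4:
  fixes k p m :: nat
  assumes "prime p" and "2 < p"
    and "1 \<le> m"
    and "infinite (UNIV :: 'f::field set)"
    and "CHAR('f) = 0 \<or> CHAR('f) = p"
  shows "GKdim_Z2 m (grassmann_star k :: ('f, (nat, 'f) fpoly set) z2_algebra) = ereal (real m)"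
proof -
  let ?B = "grassmann_star k :: ('f, (nat, 'f) fpoly set) z2_algebra"
  let ?R = "rel_free_Z2 m ?B"
  define X where "X = Y ` {1..m} \<union> Z ` {1..m}"
  have "\<not> CHAR('f) dvd 2"
    using assms(2,5) by (auto dest: dvd_imp_le)
  then have two: "(2::'f) \<noteq> 0"
    using of_nat_eq_0_iff_char_dvd[of 2, where 'a = 'f] by simp
  interpret T: lie_nilpotent_ideal "T_Z2 ?B"
    by (rule lie_nilpotent_ideal_T_Z2[OF two])
  have ideal: "ideal (free_polys X \<inter> T_Z2 ?B) (free_alg X)"
    by (intro ideal_T_Z2 f_algebra_grassmann_star) (simp_all add: star_component_subset)
  interpret Q: free_quotient X "free_polys X \<inter> T_Z2 ?B" by (rule free_quotient.intro[OF ideal])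
  have R: "?R = Q.Q" by (simp add: rel_free_Z2_def free_alg_YZ_def X_def)
  interpret R: f_algebra ?R by (rule f_algebra_rel_free)
  have K: "subfield (scalars ?R) ?R" by (rule subfield_scalars_rel_free)
  have one: "\<one>\<^bsub>?R\<^esub> \<noteq> \<zero>\<^bsub>?R\<^esub>"
    by (rule subfieldE(6)[OF K])
  then have one_T: "1 \<notin> T_Z2 ?B"
    unfolding R Q.cl_simps(3)[symmetric] by (simp add: Q.cl_eq_zero_iff del: quot_alg_simps)

  define xs where "xs = map Y [1..<Suc m] @ map Z [1..<Suc m]"
  have xs: "distinct xs" "set xs = X"
    by (auto simp: xs_def X_def distinct_map inj_on_def atLeastLessThanSuc_atLeastAtMost)
  have "X - range Z = Y ` {1..m}" by (auto simp: X_def)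
  then have card: "card (X - range Z) = m" by (simp add: card_image inj_on_def)
  have filtered: "polynomially_filtered ?R m"
    using T.polynomially_filtered_quotient[where N = "range Z" and k = k,
      OF xs(1) star_nilpotent_letter[OF two] one_T ideal[folded xs(2)]]
    unfolding xs(2) R card by simp

  \<comment> \<open>The span of the even variables already realises the full growth.\<close>
  define V where "V = R.Span (scalars ?R) (map (\<lambda>i. Q.cl (gen (Y i))) [1..<Suc m])"
  have genc: "set (map (\<lambda>i. Q.cl (gen (Y i))) [1..<Suc m]) \<subseteq> carrier ?R"
  proof -
    have "Q.cl (gen (Y i)) \<in> carrier ?R" if "i \<in> {1..m}" for i
      unfolding R using that by (intro Q.cl_closed) (simp add: X_def)
    then show ?thesis by auto
  qed
  have V: "R.finite_dimension (scalars ?R) V"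
    unfolding V_def by (rule R.Span_finite_dimension[OF K genc])
  have genV: "Q.cl (gen (Y i)) \<in> V" if "i \<in> {1..m}" for i
  proof -
    have "i \<in> set [1..<Suc m]" using that by auto
    then have "Q.cl (gen (Y i)) \<in> set (map (\<lambda>i. Q.cl (gen (Y i))) [1..<Suc m])"
      unfolding set_map by (rule imageI)
    then show ?thesis
      unfolding V_def by (rule subsetD[OF R.Span_base_incl[OF K genc]])
  qed
  define bs where "bs = (\<lambda>q. map (\<lambda>e. Q.cl (fmonom (kronecker_word q m e))) (rev [0..<q ^ m]))"
  have ind: "R.independent (scalars ?R) (bs q)" for q
    unfolding bs_def X_def by (rule kronecker_words_independent[OF assms(4)]) simp
  have words: "set (bs q) \<subseteq> list_prod ?R ` {vs \<in> lists V. length vs \<le> m * q}" for q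
  proof
    fix b assume "b \<in> set (bs q)"
    then obtain e where e: "e < q ^ m" "b = Q.cl (fmonom (kronecker_word q m e))"
      by (auto simp: bs_def)
    let ?w = "map (\<lambda>x. Q.cl (gen x)) (kronecker_word q m e)"
    have "b = list_prod ?R ?w"
      unfolding R e(2) using set_kronecker_word[of q m e]
      by (intro Q.list_prod_cl[symmetric]) (auto simp: X_def)
    moreover have "?w \<in> lists V"
    proof -
      have "Q.cl (gen x) \<in> V" if "x \<in> set (kronecker_word q m e)" for x
        using subsetD[OF set_kronecker_word that] genV by auto
      then show ?thesis by auto
    qed
    moreover have "length ?w \<le> m * q"
      using length_kronecker_word[OF e(1)] by simp
    ultimately show "b \<in> list_prod ?R ` {vs \<in> lists V. length vs \<le> m * q}" by blast
  qed
  have "ereal (real m) \<le> GKdim ?R"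
    by (rule R.GKdim_ge_of_independent[OF one filtered assms(3) V ind _ words]) (simp add: bs_def)
  moreover have "GKdim ?R \<le> ereal (real m)"
    by (rule R.GKdim_le_of_filtered[OF one filtered])
  ultimately show ?thesis
    unfolding GKdim_Z2_def by simp
qed

end
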